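(* Let $S_x,S_y\subset\mathbb{R}^3$ be non-degenerate flat triangles with $S_x\cap S_y=\emptyset$, and let $G(\mathbf{x},\mathbf{y})=1/|\mathbf{x}-\mathbf{y}|$. Then $$M'=\int_{S_y}\mathbf{n}_y\cdot\nabla_{\mathbf{y}}\int_{S_x}\mathbf{n}_x\cdot\nabla_{\mathbf{x}}G(\mathbf{x},\mathbf{y})\,dS(\mathbf{x})\,dS(\mathbf{y})=-\sum_{i=1}^3\sum_{j=1}^3\frac{\mathbf{l}_{xi}\cdot\mathbf{l}_{yj}}{l_{xi}l_{yj}}H_{ij},$$ where $$H_{ij}=l_{xi}l_{yj}\int_0^1\int_0^1\frac{ds_2\,ds_1}{|\mathbf{l}_{xi}s_1-\mathbf{l}_{yj}s_2+\mathbf{x}_i-\mathbf{y}_j|}.$$ Moreover, for every pair $(i,j)$ such that $\mathbf{l}_{xi},\mathbf{l}_{yj},\mathbf{x}_i-\mathbf{y}_j$ are not all collinear, $H_{ij}=l_{xi}l_{yj}\,\widehat Q(\mathbf{l}_{xi},-\mathbf{l}_{yj};\mathbf{x}_i-\mathbf{y}_j)$ with the closed-form expression $\widehat Q$ defined in the context.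
   Context: $S_x$ has vertices $\mathbf{x}_1,\mathbf{x}_2,\mathbf{x}_3$ and area $A_x$; $\mathbf{l}_{x1}=\mathbf{x}_2-\mathbf{x}_1$, $\mathbf{l}_{x2}=\mathbf{x}_3-\mathbf{x}_2$, $\mathbf{l}_{x3}=\mathbf{x}_1-\mathbf{x}_3$, $l_{xi}=|\mathbf{l}_{xi}|$, $\mathbf{n}_x=-(\mathbf{l}_{x1}\times\mathbf{l}_{x3})/(2A_x)$; likewise with $y$ for $S_y$. For vectors $\mathbf{a}_1,\dots,\mathbf{a}_d,\mathbf{e}\in\mathbb{R}^3$ write $\mathbf{e}=\mathbf{e}_{\Vert}+\mathbf{e}_{\perp}$ with $\mathbf{e}_{\Vert}\in\mathrm{span}(\mathbf{a}_1,\dots,\mathbf{a}_d)$ and $\mathbf{e}_\perp$ orthogonal to that span; $h_d=|\mathbf{e}_\perp|$; $s_{10},\dots,s_{d0}$ are reals with $\mathbf{e}_\Vert=\sum_i s_{i0}\mathbf{a}_i$ (any fixed choice if not unique). Define, omitting terms with zero coefficient, $$\widehat Q(\mathbf{a}_1,\mathbf{a}_2;\mathbf{e})=(1+s_{10})\widehat I_1(\mathbf{a}_2;\mathbf{e}_\Vert+\mathbf{a}_1)-s_{10}\widehat I_1(\mathbf{a}_2;\mathbf{e}_\Vert)+(1+s_{20})\widehat I_1(\mathbf{a}_1;\mathbf{e}_\Vert+\mathbf{a}_2)-s_{20}\widehat I_1(\mathbf{a}_1;\mathbf{e}_\Vert)$$ ($d=2$ data $s_{i0},\mathbf{e}_\Vert,h_2$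 of the left-hand arguments), and, with $d=1$ data $s_{10},h_1$ of the arguments of $\widehat I_1$ and $h_2$ inherited from $\widehat Q$, $$\widehat I_1(\mathbf{a}_1;\mathbf{e})=(1+s_{10})\widehat F_1(|1+s_{10}||\mathbf{a}_1|)-s_{10}\widehat F_1(|s_{10}||\mathbf{a}_1|).$$ Here for $P>0$, with $h=\sqrt{h_1^2+h_2^2}$ and $R=\sqrt{P^2+h^2}$: - if $h_1\neq0,h_2=0$: $\widehat F_1(P)=\frac1P\ln\frac{P+R}{h}$; - if $h_1=0,h_2\neq0$: $\widehat F_1(P)=\frac1P\ln\frac{P+R}{h}-\frac1{R+h_2}$; - if $h_1,h_2\neq0$: $\widehat F_1(P)=\frac1P\ln\frac{P+R}{h}-\frac{h_2}{h_1}\frac1P\arctan\frac{h_1P}{h^2+Rh_2}$. *)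

theory Defs
  imports "HOL-Analysis.Analysis"
begin

section \<open>Triangles in space\<close>

text \<open>
  A triangle is given by its vertices \<open>x 1\<close>, \<open>x 2\<close>, \<open>x 3\<close>; other values of \<open>x\<close> are irrelevant.
\<close>

definition flat_triangle :: "(nat \<Rightarrow> real^3) \<Rightarrow> (real^3) set" where
  "flat_triangle x = convex hull {x 1, x 2, x 3}"

text \<open>Indices are cyclic: for \<open>i = 1, 2, 3\<close> the successor \<open>i mod 3 + 1\<close> is \<open>2, 3, 1\<close>.\<close>

definition edge :: "(nat \<Rightarrow> real^3) \<Rightarrow> nat \<Rightarrow> real^3" where
  "edge x i = x (i mod 3 + 1) - x i"

definition area :: "(nat \<Rightarrow> real^3) \<Rightarrow> real" where
  "area x = norm (cross3 (x 2 - x 1) (x 3 - x 1)) / 2"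

definition normal :: "(nat \<Rightarrow> real^3) \<Rightarrow> real^3" where
  "normal x = - ((1 / (2 * area x)) *\<^sub>R cross3 (edge x 1) (edge x 3))"

text \<open>
  The surface integral of \<open>f\<close> over the triangle, through the affine parametrisation
  \<open>(u, v) \<mapsto> x 1 + u (x 2 - x 1) + v (x 3 - x 1)\<close> by the standard simplex, whose surface element
  is \<open>dS = |(x 2 - x 1) \<times> (x 3 - x 1)| du dv = 2 * area x du dv\<close>.
\<close>

definition triangle_integral :: "(nat \<Rightarrow> real^3) \<Rightarrow> (real^3 \<Rightarrow> real) \<Rightarrow> real" where
  "triangle_integral x f =
     2 * area x *
     integral {(u::real, v::real). 0 \<le> u \<and> 0 \<le> v \<and> u + v \<le> 1}
       (\<lambda>(u, v). f (x 1 + u *\<^sub>R (x 2 - x 1) + v *\<^sub>R (x 3 - x 1)))"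

definition grad :: "('a::real_inner \<Rightarrow> real) \<Rightarrow> 'a \<Rightarrow> 'a" where
  "grad f p = (THE D. GDERIV f p :> D)"

definition newton_kernel :: "real^3 \<Rightarrow> real^3 \<Rightarrow> real" where
  "newton_kernel p q = 1 / norm (p - q)"

definition edge_integral :: "(nat \<Rightarrow> real^3) \<Rightarrow> (nat \<Rightarrow> real^3) \<Rightarrow> nat \<Rightarrow> nat \<Rightarrow> real" where
  "edge_integral x y i j =
     norm (edge x i) * norm (edge y j) *
     integral {0..1::real} (\<lambda>s1. integral {0..1::real} (\<lambda>s2.
       1 / norm (s1 *\<^sub>R edge x i - s2 *\<^sub>R edge y j + x i - y j)))"


section \<open>The closed-form expression\<close>

definition par :: "'a::euclidean_space set \<Rightarrow> 'a \<Rightarrow> 'a" where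
  "par A e = (THE p. p \<in> span A \<and> (\<forall>w\<in>span A. orthogonal (e - p) w))"

definition height :: "'a::euclidean_space set \<Rightarrow> 'a \<Rightarrow> real" where
  "height A e = norm (e - par A e)"

text \<open>
  Only used for \<open>P > 0\<close>. The combination \<open>h1 = h2 = 0\<close> has no meaning and is left unspecified.
\<close>

definition Fhat1 :: "real \<Rightarrow> real \<Rightarrow> real \<Rightarrow> real" where
  "Fhat1 h1 h2 P =
     (let h = sqrt (h1\<^sup>2 + h2\<^sup>2); R = sqrt (P\<^sup>2 + h\<^sup>2) in
      if h1 \<noteq> 0 \<and> h2 = 0 then 1 / P * ln ((P + R) / h)
      else if h1 = 0 \<and> h2 \<noteq> 0 then 1 / P * ln ((P + R) / h) - 1 / (R + h2)
      else if h1 \<noteq> 0 \<and> h2 \<noteq> 0 then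
        1 / P * ln ((P + R) / h) - h2 / h1 * (1 / P) * arctan (h1 * P / (h\<^sup>2 + R * h2))
      else undefined)"

text \<open>
  All functions are total and \<open>0 * c = 0\<close> for every real \<open>c\<close>, so in the next two definitions a term
  with zero coefficient is omitted automatically, including those in which \<open>Fhat1\<close> is unspecified
  or is applied to \<open>P = 0\<close>.

  In \<open>Ihat1\<close> the coefficient \<open>s\<close> is unique unless \<open>a = 0\<close>. In \<open>Qhat\<close> the coefficients need not be
  unique (parallel \<open>a1\<close>, \<open>a2\<close>); they are the parameters \<open>s1\<close>, \<open>s2\<close>, meant to satisfy
  \<open>par {a1, a2} e = s1 a1 + s2 a2\<close>.
\<close>

definition Ihat1 :: "real \<Rightarrow> 'a::euclidean_space \<Rightarrow> 'a \<Rightarrow> real" where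
  "Ihat1 h2 a e =
     (let s = (SOME s. par {a} e = s *\<^sub>R a); h1 = height {a} e in
      (1 + s) * Fhat1 h1 h2 (\<bar>1 + s\<bar> * norm a) - s * Fhat1 h1 h2 (\<bar>s\<bar> * norm a))"

definition Qhat :: "real \<Rightarrow> real \<Rightarrow> 'a::euclidean_space \<Rightarrow> 'a \<Rightarrow> 'a \<Rightarrow> real" where
  "Qhat s1 s2 a1 a2 e =
     (let p = par {a1, a2} e; h2 = height {a1, a2} e in
      (1 + s1) * Ihat1 h2 a2 (p + a1) - s1 * Ihat1 h2 a2 p +
      (1 + s2) * Ihat1 h2 a1 (p + a2) - s2 * Ihat1 h2 a1 p)"

end

theory Submission
  imports Defs
begin

text \<open>
  With \<open>r = p - q\<close> and \<open>H\<close> the Hessian of \<open>1 / |r|\<close>, which is trace-free because the kernel is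
  harmonic, the integrand \<open>- H(n\<^sub>x, n\<^sub>y)\<close> with \<open>n\<^sub>y\<close> proportional to \<open>c \<times> d\<close> equals
  \<open>(n\<^sub>x \<times> c) \<bullet> H d - (n\<^sub>x \<times> d) \<bullet> H c\<close> up to that factor. Stokes' theorem on the first triangle
  therefore turns the inner integral into edge potentials, and Stokes' theorem on the second
  triangle turns the rest into the double edge integrals.

  The double edge integral is the integral over the unit square of \<open>1 / sqrt (|u|\<^sup>2 + h\<^sup>2)\<close> for an
  affine map \<open>u\<close> into the span of the two edges, with \<open>h\<close> constant. It is the divergence of
  \<open>u / (sqrt (|u|\<^sup>2 + h\<^sup>2) + h)\<close> in the coordinates of \<open>u\<close>, so only integrals over the four
  sides remain, which have elementary primitives.
\<close>

section \<open>The standard simplex\<close>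

abbreviation std_simplex :: "(real \<times> real) set" where
  "std_simplex \<equiv> {(u::real, v::real). 0 \<le> u \<and> 0 \<le> v \<and> u + v \<le> 1}"

lemma closed_std_simplex: "closed std_simplex"
proof -
  have "std_simplex = {z. 0 \<le> fst z} \<inter> {z. 0 \<le> snd z} \<inter> {z. fst z + snd z \<le> 1}"
    by auto
  then show ?thesis
    by (auto intro!: closed_Int closed_Collect_le continuous_intros)
qed

lemma compact_std_simplex: "compact std_simplex"
proof -
  have "std_simplex \<subseteq> cbox (0,0) (1,1)" by (auto simp: cbox_Pair_eq)
  then show ?thesis
    using bounded_subset[OF bounded_cbox] closed_std_simplex
    by (intro compact_eq_bounded_closed[THEN iffD2] conjI)
qed

lemma set_integrable_std_simplex:
  fixes f :: "real \<times> real \<Rightarrow> real"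
  assumes "continuous_on std_simplex f"
  shows "set_integrable lborel std_simplex f"
  unfolding set_integrable_def by (rule borel_integrable_compact[OF compact_std_simplex assms])

text \<open>Fubini for the Lebesgue integral of \<open>f\<close> extended by zero; continuity on a
  compact set makes it agree with the gauge integral. The inner integral in \<open>v\<close> is then
  open to the fundamental theorem of calculus.\<close>

lemma integral_std_simplex_fst:
  fixes f :: "real \<times> real \<Rightarrow> real"
  assumes cont: "continuous_on std_simplex f"
  shows "integral std_simplex f = integral {0..1} (\<lambda>u. integral {0..1-u} (\<lambda>v. f (u, v)))"
proof -
  let ?g = "\<lambda>z. indicator std_simplex z *\<^sub>R f z"
  have int: "integrable (lborel \<Otimes>\<^sub>M lborel) ?g"
    using set_integrable_std_simplex[OF cont] by (simp add: set_integrable_def lborel_prod)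
  have inner: "(\<integral>v. ?g (u, v) \<partial>lborel)
      = indicator {0..1} u *\<^sub>R integral {0..1-u} (\<lambda>v. f (u, v))" for u
  proof (cases "u \<in> {0..1}")
    case True
    have eq: "?g (u, v) = indicator {0..1-u} v *\<^sub>R f (u, v)" for v
      using True by (auto simp: indicator_def)
    have "set_integrable lborel {0..1-u} (\<lambda>v. f (u, v))"
      unfolding set_integrable_def
      by (rule borel_integrable_compact)
        (use True in \<open>auto intro!: continuous_on_compose2[OF cont] continuous_intros\<close>)
    from set_borel_integral_eq_integral(2)[OF this] show ?thesis
      unfolding eq using True by (simp add: set_lebesgue_integral_def)
  next
    case False
    then have eq: "?g (u, v) = 0" for v by (auto simp: indicator_def)
    show ?thesis unfolding eq using False by simp
  qed
  have si: "set_integrable lborel {0..1} (\<lambda>u. integral {0..1-u} (\<lambda>v. f (u, v)))"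
    using lborel_pair.integrable_fst'[OF int] unfolding inner set_integrable_def .
  have "integral std_simplex f = (\<integral>z. ?g z \<partial>(lborel \<Otimes>\<^sub>M lborel))"
    using set_borel_integral_eq_integral(2)[OF set_integrable_std_simplex[OF cont]]
    by (simp add: set_lebesgue_integral_def lborel_prod)
  also have "\<dots> = (\<integral>u. (\<integral>v. ?g (u, v) \<partial>lborel) \<partial>lborel)"
    by (rule lborel_pair.integral_fst'[OF int, symmetric])
  also have "\<dots> = integral {0..1} (\<lambda>u. integral {0..1-u} (\<lambda>v. f (u, v)))"
    using set_borel_integral_eq_integral(2)[OF si]
    unfolding inner set_lebesgue_integral_def by simp
  finally show ?thesis .
qed

text \<open>The simplex is symmetric in its coordinates, so facts about the second variable carry
  over to the first.\<close>

lemma integral_std_simplex_swap: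
  fixes f :: "real \<times> real \<Rightarrow> real"
  assumes cont: "continuous_on std_simplex f"
  shows "integral std_simplex f = integral std_simplex (\<lambda>(u, v). f (v, u))"
proof -
  let ?g = "\<lambda>z. indicator std_simplex z *\<^sub>R f z"
  have cont': "continuous_on std_simplex (\<lambda>(u, v). f (v, u))"
    unfolding case_prod_unfold
    by (auto intro!: continuous_on_compose2[OF cont] continuous_intros)
  have int: "integrable (lborel \<Otimes>\<^sub>M lborel) ?g"
    using set_integrable_std_simplex[OF cont] by (simp add: set_integrable_def lborel_prod)
  have "integral std_simplex f = (\<integral>z. ?g z \<partial>(lborel \<Otimes>\<^sub>M lborel))"
    using set_borel_integral_eq_integral(2)[OF set_integrable_std_simplex[OF cont]]
    by (simp add: set_lebesgue_integral_def lborel_prod)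
  also have "\<dots> = (\<integral>(u, v). ?g (v, u) \<partial>(lborel \<Otimes>\<^sub>M lborel))"
    by (rule lborel_pair.integral_product_swap[symmetric]) (use int in simp)
  also have "\<dots> = (\<integral>z. indicator std_simplex z *\<^sub>R (case z of (u, v) \<Rightarrow> f (v, u)) \<partial>lborel)"
    unfolding lborel_prod by (rule Bochner_Integration.integral_cong) (auto simp: indicator_def)
  also have "\<dots> = integral std_simplex (\<lambda>(u, v). f (v, u))"
    using set_borel_integral_eq_integral(2)[OF set_integrable_std_simplex[OF cont']]
    by (simp add: set_lebesgue_integral_def)
  finally show ?thesis .
qed

text \<open>Duffy's transformation of the simplex to the unit square.\<close>

lemma integral_std_simplex_square:
  fixes f :: "real \<times> real \<Rightarrow> real"
  assumes cont: "continuous_on std_simplex f"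
  shows "integral std_simplex f
    = integral (cbox (0,0) (1,1)) (\<lambda>(u, w). (1 - u) * f (u, (1 - u) * w))"
proof -
  have in_simplex: "(u, (1 - u) * w) \<in> std_simplex" if "0 \<le> u" "u \<le> 1" "0 \<le> w" "w \<le> 1" for u w
    using that mult_left_le[of w "1 - u"] by auto
  have cont': "continuous_on (cbox (0,0) (1,1)) (\<lambda>(u, w). (1 - u) * f (u, (1 - u) * w))"
    unfolding case_prod_unfold
    using in_simplex
    by (auto intro!: continuous_on_compose2[OF cont] continuous_intros simp: cbox_Pair_eq)
  have *: "integral {0..1-u} (\<lambda>v. f (u, v)) = integral {0..1} (\<lambda>w. (1 - u) * f (u, (1 - u) * w))"
    if "u \<in> {0..1}" for u
  \<comment> \<open>The substitution \<open>v = (1 - u) w\<close> degenerates at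
    \<open>u = 1\<close>; there the interval is a point and the factor \<open>1 - u\<close>
    vanishes, so both sides are 0.\<close>
  proof (cases "u = 1")
    case False
    with that have u: "0 < 1 - u" by auto
    have "continuous_on {0..1-u} (\<lambda>v. f (u, v))"
      using that by (auto intro!: continuous_on_compose2[OF cont] continuous_intros)
    then have "((\<lambda>v. f (u, v)) has_integral integral {0..1-u} (\<lambda>v. f (u, v))) (cbox 0 (1 - u))"
      by (simp add: integrable_continuous_real integrable_integral)
    from has_integral_affinity'[OF this u, of 0]
    have "((\<lambda>w. f (u, (1 - u) * w)) has_integral integral {0..1-u} (\<lambda>v. f (u, v)) / (1 - u)) {0..1}"
      using u by (simp add: field_simps)
    from integral_unique[OF has_integral_mult_right[OF this, of "1 - u"]] show ?thesis
      using u by simp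
  qed auto
  have "integral std_simplex f = integral {0..1} (\<lambda>u. integral {0..1-u} (\<lambda>v. f (u, v)))"
    by (rule integral_std_simplex_fst[OF cont])
  also have "\<dots> = integral {0..1} (\<lambda>u. integral {0..1} (\<lambda>w. (1 - u) * f (u, (1 - u) * w)))"
    by (rule integral_cong) (rule *)
  finally show ?thesis
    using integral_prod_continuous[OF cont'] by simp
qed

lemma integral_unit_interval_flip:
  fixes f :: "real \<Rightarrow> real"
  shows "integral {0..1} (\<lambda>t. f (1 - t)) = integral {0..1} f"
proof -
  have "integral {0..1} (\<lambda>t. f (1 - t)) = integral {-1..0} (\<lambda>t. f (1 + t))"
    using Henstock_Kurzweil_Integration.integral_reflect_real[of 0 "-1" "\<lambda>t. f (1 + t)"] by simp
  also have "\<dots> = integral {0..1} f"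
    using integral_shift_real_ivl[of 0 1 1 f] by (simp add: add.commute)
  finally show ?thesis .
qed

section \<open>Stokes' theorem on a triangle\<close>

text \<open>The fundamental theorem of calculus on each segment with \<open>u\<close> fixed leaves
  boundary values on the hypotenuse and on the side \<open>v = 0\<close>. The hypotenuse is run from
  (1, 0) to (0, 1), the direction of the second edge of a triangle.\<close>

lemma simplex_integral_partial_snd:
  fixes f fv :: "real \<times> real \<Rightarrow> real"
  assumes cont: "continuous_on std_simplex f" and cont': "continuous_on std_simplex fv"
    and der: "\<And>u v. (u, v) \<in> std_simplex \<Longrightarrow>
      ((\<lambda>v. f (u, v)) has_real_derivative fv (u, v)) (at v)"
  shows "integral std_simplex fv
    = integral {0..1} (\<lambda>t. f (1 - t, t)) - integral {0..1} (\<lambda>t. f (t, 0))"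
proof -
  have *: "integral {0..1-u} (\<lambda>v. fv (u, v)) = f (u, 1 - u) - f (u, 0)" if "u \<in> {0..1}" for u
    by (intro integral_unique fundamental_theorem_of_calculus)
      (use that in \<open>auto simp: has_real_derivative_iff_has_vector_derivative[symmetric]
         intro!: DERIV_subset[OF der]\<close>)
  have "integral std_simplex fv = integral {0..1} (\<lambda>u. f (u, 1 - u) - f (u, 0))"
    unfolding integral_std_simplex_fst[OF cont'] by (rule integral_cong) (rule *)
  also have "\<dots> = integral {0..1} (\<lambda>u. f (u, 1 - u)) - integral {0..1} (\<lambda>u. f (u, 0))"
    by (intro Henstock_Kurzweil_Integration.integral_diff integrable_continuous_real
        continuous_on_compose2[OF cont] continuous_intros) auto
  also have "integral {0..1} (\<lambda>u. f (u, 1 - u)) = integral {0..1} (\<lambda>t. f (1 - t, t))"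
    using integral_unit_interval_flip[of "\<lambda>u. f (u, 1 - u)"] by simp
  finally show ?thesis .
qed

text \<open>The previous lemma with the coordinates exchanged. Flipping \<open>t\<close> orients the
  boundary integrals like the second and third edges.\<close>

lemma simplex_integral_partial_fst:
  fixes f fu :: "real \<times> real \<Rightarrow> real"
  assumes cont: "continuous_on std_simplex f" and cont': "continuous_on std_simplex fu"
    and der: "\<And>u v. (u, v) \<in> std_simplex \<Longrightarrow>
      ((\<lambda>u. f (u, v)) has_real_derivative fu (u, v)) (at u)"
  shows "integral std_simplex fu
    = integral {0..1} (\<lambda>t. f (1 - t, t)) - integral {0..1} (\<lambda>t. f (0, 1 - t))"
proof -
  let ?f = "\<lambda>(u, v). f (v, u)" and ?fu = "\<lambda>(u, v). fu (v, u)"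
  have c: "continuous_on std_simplex ?f" "continuous_on std_simplex ?fu"
    unfolding case_prod_unfold
    by (auto intro!: continuous_on_compose2[OF cont] continuous_on_compose2[OF cont']
        continuous_intros)
  have "integral std_simplex fu
      = integral {0..1} (\<lambda>t. ?f (1 - t, t)) - integral {0..1} (\<lambda>t. ?f (t, 0))"
    unfolding integral_std_simplex_swap[OF cont']
    by (rule simplex_integral_partial_snd[OF c]) (auto intro!: der)
  then show ?thesis
    using integral_unit_interval_flip[of "\<lambda>t. f (t, 1 - t)"]
      integral_unit_interval_flip[of "\<lambda>t. f (0, t)"] by simp
qed

abbreviation triangle_point :: "(nat \<Rightarrow> real^3) \<Rightarrow> real \<Rightarrow> real \<Rightarrow> real^3" where
  "triangle_point x u v \<equiv> x 1 + u *\<^sub>R (x 2 - x 1) + v *\<^sub>R (x 3 - x 1)"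

lemma triangle_point_mem:
  assumes "(u, v) \<in> std_simplex"
  shows "triangle_point x u v \<in> flat_triangle x"
proof -
  have "triangle_point x u v = (1 - u - v) *\<^sub>R x 1 + u *\<^sub>R x 2 + v *\<^sub>R x 3"
    by (simp add: algebra_simps)
  then show ?thesis
    unfolding flat_triangle_def convex_hull_3 mem_Collect_eq using assms
    by (intro exI[of _ "1 - u - v"] exI[of _ u] exI[of _ v]) auto
qed

lemma edge_1_2_3: "edge x 1 = x 2 - x 1" "edge x 2 = x 3 - x 2" "edge x 3 = x 1 - x 3"
proof -
  have "1 mod 3 + 1 = (2::nat)" "2 mod 3 + 1 = (3::nat)" "3 mod 3 + 1 = (1::nat)" by simp_all
  then show "edge x 1 = x 2 - x 1" "edge x 2 = x 3 - x 2" "edge x 3 = x 1 - x 3"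
    unfolding edge_def by metis+
qed

lemma edge_point_mem:
  assumes "t \<in> {0..1}" "i \<in> {1..3}"
  shows "x i + t *\<^sub>R edge x i \<in> flat_triangle x"
proof -
  have "i = 1 \<or> i = 2 \<or> i = 3" using assms by auto
  moreover have "x 1 + t *\<^sub>R edge x 1 \<in> flat_triangle x"
    using triangle_point_mem[of t 0 x] assms(1) by (simp add: edge_1_2_3[simplified])
  moreover have "x 2 + t *\<^sub>R edge x 2 = triangle_point x (1 - t) t"
    "x 3 + t *\<^sub>R edge x 3 = triangle_point x 0 (1 - t)"
    by (simp_all add: edge_1_2_3 algebra_simps)
  ultimately show ?thesis
    using triangle_point_mem[of "1 - t" t x] triangle_point_mem[of 0 "1 - t" x] assms(1)
    by (elim disjE) (simp_all del: One_nat_def)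
qed

text \<open>Clearing the denominator gives an identity that survives degeneration: if the area is 0,
  so is the cross product on the right.\<close>

lemma double_area_normal: "(2 * area x) *\<^sub>R normal x = cross3 (x 2 - x 1) (x 3 - x 1)"
proof -
  have "cross3 (edge x 1) (edge x 3) = - cross3 (x 2 - x 1) (x 3 - x 1)"
    using cross_minus_right[of "x 2 - x 1" "x 3 - x 1"] by (simp add: edge_1_2_3 del: One_nat_def)
  then show ?thesis
    by (cases "area x = 0") (auto simp: normal_def area_def)
qed

lemma GDERIV_continuous_on:
  assumes "\<And>p. p \<in> S \<Longrightarrow> GDERIV F p :> D p"
  shows "continuous_on S F"
proof (rule continuous_at_imp_continuous_on, intro ballI)
  fix p assume "p \<in> S"
  then show "isCont F p"
    by (rule has_derivative_continuous[OF assms[unfolded gderiv_def]])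
qed

lemma GDERIV_along_line:
  assumes "GDERIV F (a + t *\<^sub>R b) :> D"
  shows "((\<lambda>t. F (a + t *\<^sub>R b)) has_real_derivative b \<bullet> D) (at t)"
proof -
  have "((\<lambda>t. a + t *\<^sub>R b) has_derivative (\<lambda>h. h *\<^sub>R b)) (at t)"
    by (auto intro!: derivative_eq_intros)
  from has_derivative_compose[OF this assms[unfolded gderiv_def]] show ?thesis
    by (simp add: has_field_derivative_def mult.commute[of "b \<bullet> D"] mult_commute_abs)
qed

lemma continuous_on_triangle_point:
  fixes f :: "real^3 \<Rightarrow> real"
  assumes "continuous_on (flat_triangle x) f"
  shows "continuous_on std_simplex (\<lambda>(u, v). f (triangle_point x u v))"
proof -
  have "continuous_on std_simplex (\<lambda>z. triangle_point x (fst z) (snd z))"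
    by (intro continuous_intros)
  moreover have "(\<lambda>z. triangle_point x (fst z) (snd z)) ` std_simplex \<subseteq> flat_triangle x"
    by (intro image_subsetI triangle_point_mem) (simp add: case_prod_unfold)
  ultimately have "continuous_on std_simplex (\<lambda>z. f (triangle_point x (fst z) (snd z)))"
    by (rule continuous_on_compose2[OF assms])
  then show ?thesis
    by (simp only: case_prod_unfold)
qed

lemma integrable_triangle_point:
  fixes f :: "real^3 \<Rightarrow> real"
  assumes "continuous_on (flat_triangle x) f"
  shows "(\<lambda>(u, v). f (triangle_point x u v)) integrable_on std_simplex"
  by (rule set_borel_integral_eq_integral(1)[OF set_integrable_std_simplex])
    (rule continuous_on_triangle_point[OF assms])

lemma triangle_integral_cong:
  assumes "\<And>p. p \<in> flat_triangle x \<Longrightarrow> f p = g p"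
  shows "triangle_integral x f = triangle_integral x g"
proof -
  have "integral std_simplex (\<lambda>(u, v). f (triangle_point x u v))
      = integral std_simplex (\<lambda>(u, v). g (triangle_point x u v))"
    using assms[OF triangle_point_mem] by (intro integral_cong) (auto simp del: One_nat_def)
  then show ?thesis unfolding triangle_integral_def by (rule arg_cong)
qed

lemma triangle_integral_diff:
  assumes "continuous_on (flat_triangle x) f" "continuous_on (flat_triangle x) g"
  shows "triangle_integral x (\<lambda>p. f p - g p) = triangle_integral x f - triangle_integral x g"
  using Henstock_Kurzweil_Integration.integral_diff
    [OF integrable_triangle_point[OF assms(1)] integrable_triangle_point[OF assms(2)]]
  unfolding triangle_integral_def case_prod_unfold by (simp add: Rings.right_diff_distrib)

lemma triangle_integral_sum:
  assumes "finite I" "\<And>i. i \<in> I \<Longrightarrow> continuous_on (flat_triangle x) (f i)"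
  shows "triangle_integral x (\<lambda>p. \<Sum>i\<in>I. f i p) = (\<Sum>i\<in>I. triangle_integral x (f i))"
  using Henstock_Kurzweil_Integration.integral_sum
    [OF assms(1) integrable_triangle_point[OF assms(2)]]
  unfolding triangle_integral_def case_prod_unfold by (simp add: sum_distrib_left)

text \<open>Stokes' theorem on a flat triangle, for the vector field \<open>F c\<close> with \<open>c\<close> constant.\<close>

lemma triangle_stokes:
  fixes x :: "nat \<Rightarrow> real^3" and F :: "real^3 \<Rightarrow> real"
  assumes der: "\<And>p. p \<in> flat_triangle x \<Longrightarrow> GDERIV F p :> D p"
    and cont: "continuous_on (flat_triangle x) D"
  shows "triangle_integral x (\<lambda>p. cross3 (normal x) c \<bullet> D p)
    = - (\<Sum>i=1..3. (edge x i \<bullet> c) * integral {0..1} (\<lambda>t. F (x i + t *\<^sub>R edge x i)))"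
proof -
  define a b where "a = x 2 - x 1" and "b = x 3 - x 1"
  define J where "J i = integral {0..1} (\<lambda>t. F (x i + t *\<^sub>R edge x i))" for i
  define P where "P = (\<lambda>z. triangle_point x (fst z) (snd z))"
  have mem: "P z \<in> flat_triangle x" if "z \<in> std_simplex" for z
    unfolding P_def by (rule triangle_point_mem) (use that in \<open>simp add: case_prod_unfold\<close>)
  have contP: "continuous_on A P" for A
    unfolding P_def by (intro continuous_intros)
  have contF: "continuous_on (flat_triangle x) F"
    by (rule GDERIV_continuous_on[OF der])
  have cF: "continuous_on std_simplex (\<lambda>z. F (P z))"
    by (rule continuous_on_compose2[OF contF contP]) (use mem in blast)
  have cD: "continuous_on std_simplex (\<lambda>z. w \<bullet> D (P z))" for w
    by (intro continuous_intros continuous_on_compose2[OF cont contP]) (use mem in blast)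
  have dv: "((\<lambda>v. F (P (u, v))) has_real_derivative b \<bullet> D (P (u, v))) (at v)"
    if "(u, v) \<in> std_simplex" for u v
    unfolding b_def P_def fst_conv snd_conv
    by (rule GDERIV_along_line der triangle_point_mem that)+
  have du: "((\<lambda>u. F (P (u, v))) has_real_derivative a \<bullet> D (P (u, v))) (at u)"
    if "(u, v) \<in> std_simplex" for u v
  proof -
    have *: "triangle_point x u v = (x 1 + v *\<^sub>R b) + u *\<^sub>R a" for u v
      by (simp add: a_def b_def)
    show ?thesis
      unfolding P_def fst_conv snd_conv *
      by (rule GDERIV_along_line) (use der[OF triangle_point_mem[OF that]] in \<open>simp only: *\<close>)
  qed
  have "x 1 + t *\<^sub>R edge x 1 = P (t, 0)" "x 2 + t *\<^sub>R edge x 2 = P (1 - t, t)"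
    "x 3 + t *\<^sub>R edge x 3 = P (0, 1 - t)" for t
    unfolding edge_1_2_3 P_def by (simp_all add: algebra_simps del: One_nat_def)
  then have I: "integral {0..1} (\<lambda>t. F (x 1 + t *\<^sub>R edge x 1)) = integral {0..1} (\<lambda>t. F (P (t, 0)))"
    "integral {0..1} (\<lambda>t. F (x 2 + t *\<^sub>R edge x 2)) = integral {0..1} (\<lambda>t. F (P (1 - t, t)))"
    "integral {0..1} (\<lambda>t. F (x 3 + t *\<^sub>R edge x 3)) = integral {0..1} (\<lambda>t. F (P (0, 1 - t)))"
    by presburger+
  \<comment> \<open>Since (a x b) x c = (a . c) b - (b . c) a, only derivatives along the two
    parameter directions occur, and these integrate to boundary terms.\<close>
  have N: "2 * area x * (cross3 (normal x) c \<bullet> w) = (a \<bullet> c) * (b \<bullet> w) - (b \<bullet> c) * (a \<bullet> w)" for w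
  proof -
    have "2 * area x * (cross3 (normal x) c \<bullet> w) = cross3 ((2 * area x) *\<^sub>R normal x) c \<bullet> w"
      by (simp add: cross_mult_left)
    also have "\<dots> = cross3 (cross3 a b) c \<bullet> w"
      by (simp only: double_area_normal a_def b_def)
    also have "\<dots> = (a \<bullet> c) * (b \<bullet> w) - (b \<bullet> c) * (a \<bullet> w)"
      by (simp add: cross3_simps)
    finally show ?thesis .
  qed
  have "triangle_integral x (\<lambda>p. cross3 (normal x) c \<bullet> D p)
      = integral std_simplex (\<lambda>z. 2 * area x * (cross3 (normal x) c \<bullet> D (P z)))"
    unfolding triangle_integral_def P_def by (simp add: case_prod_unfold)
  also have "\<dots> = integral std_simplex (\<lambda>z. (a \<bullet> c) * (b \<bullet> D (P z)) - (b \<bullet> c) * (a \<bullet> D (P z)))"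
    by (simp only: N)
  also have "\<dots> = (a \<bullet> c) * integral std_simplex (\<lambda>z. b \<bullet> D (P z))
      - (b \<bullet> c) * integral std_simplex (\<lambda>z. a \<bullet> D (P z))"
    by (intro integral_unique has_integral_diff has_integral_mult_right integrable_integral
        set_borel_integral_eq_integral(1)[OF set_integrable_std_simplex[OF cD]])
  also have "integral std_simplex (\<lambda>z. b \<bullet> D (P z))
      = integral {0..1} (\<lambda>t. F (P (1 - t, t))) - integral {0..1} (\<lambda>t. F (P (t, 0)))"
    by (rule simplex_integral_partial_snd[OF cF cD dv])
  also have "integral std_simplex (\<lambda>z. a \<bullet> D (P z))
      = integral {0..1} (\<lambda>t. F (P (1 - t, t))) - integral {0..1} (\<lambda>t. F (P (0, 1 - t)))"
    by (rule simplex_integral_partial_fst[OF cF cD du])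
  finally have "triangle_integral x (\<lambda>p. cross3 (normal x) c \<bullet> D p)
    = (a \<bullet> c) * (J 2 - J 1) - (b \<bullet> c) * (J 2 - J 3)"
    by (simp only: I J_def)
  \<comment> \<open>\<open>a\<close>, \<open>b - a\<close> and \<open>- b\<close> are the edges in
    cyclic order; the hypotenuse receives contributions from both partial derivatives.\<close>
  also have "\<dots> = - ((a \<bullet> c) * J 1 + ((b - a) \<bullet> c) * J 2 + ((- b) \<bullet> c) * J 3)"
    by (simp add: algebra_simps)
  also have "\<dots> = - (\<Sum>i\<in>{1, 2, 3::nat}. (edge x i \<bullet> c) * J i)"
    by (simp add: edge_1_2_3 a_def b_def del: One_nat_def)
  also have "{1, 2, 3::nat} = {1..3}" by auto
  finally show ?thesis
    unfolding J_def .
qed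

section \<open>The Newton kernel\<close>

lemma grad_eqI:
  assumes "GDERIV f p :> D"
  shows "grad f p = D"
  unfolding grad_def
proof (rule the_equality)
  fix D' assume "GDERIV f p :> D'"
  with assms have "(\<lambda>h. h \<bullet> D') = (\<lambda>h. h \<bullet> D)"
    unfolding gderiv_def by (metis has_derivative_unique)
  then show "D' = D" by (metis inner_commute vector_eq_ldot)
qed (rule assms)

text \<open>The Leibniz rule asks for a convex parameter set and a derivative given as a bounded
  linear map. Hence the ball inside \<open>U\<close>, and the gradient wrapped in
  \<open>blinfun_inner_right\<close>, which is linear and so commutes with the integral.\<close>

lemma GDERIV_integral:
  fixes f :: "'a::euclidean_space \<Rightarrow> 'b::euclidean_space \<Rightarrow> real"
  assumes U: "open U" "q \<in> U"
    and der: "\<And>q t. q \<in> U \<Longrightarrow> t \<in> cbox a b \<Longrightarrow> GDERIV (\<lambda>q. f q t) q :> D q t"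
    and int: "\<And>q. q \<in> U \<Longrightarrow> continuous_on (cbox a b) (f q)"
    and cont: "continuous_on (U \<times> cbox a b) (\<lambda>(q, t). D q t)"
  shows "GDERIV (\<lambda>q. integral (cbox a b) (f q)) q :> integral (cbox a b) (D q)"
proof -
  obtain e where e: "0 < e" "ball q e \<subseteq> U"
    using U by (rule openE)
  have contq: "continuous_on (cbox a b) (D q)"
  proof -
    have "continuous_on (cbox a b) (\<lambda>t. (q, t))" by (intro continuous_intros)
    moreover have "(\<lambda>t. (q, t)) ` cbox a b \<subseteq> U \<times> cbox a b" using U by blast
    ultimately show ?thesis using continuous_on_compose2[OF cont] by fastforce
  qed
  have "((\<lambda>q. integral (cbox a b) (f q)) has_derivative
      blinfun_apply (integral (cbox a b) (\<lambda>t. blinfun_inner_right (D q t)))) (at q within ball q e)"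
  proof (rule leibniz_rule[where fx = "\<lambda>q t. blinfun_inner_right (D q t)"])
    fix q' t assume "q' \<in> ball q e" "t \<in> cbox a b"
    with e der have "GDERIV (\<lambda>q. f q t) q' :> D q' t" by blast
    then show "((\<lambda>q. f q t) has_derivative blinfun_apply (blinfun_inner_right (D q' t)))
        (at q' within ball q e)"
      unfolding gderiv_def blinfun_inner_right.rep_eq inner_commute[of _ "D q' t"]
      by (rule has_derivative_at_withinI)
  next
    show "continuous_on (ball q e \<times> cbox a b) (\<lambda>(q, t). blinfun_inner_right (D q t))"
      unfolding case_prod_unfold
      by (rule bounded_linear.continuous_on[OF bounded_linear_blinfun_inner_right])
        (use continuous_on_subset[OF cont, of "ball q e \<times> cbox a b"] e(2)
          in \<open>auto simp: case_prod_unfold\<close>)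
  qed (use e int in \<open>auto intro!: integrable_continuous\<close>)
  also have "integral (cbox a b) (\<lambda>t. blinfun_inner_right (D q t))
      = blinfun_inner_right (integral (cbox a b) (D q))"
    using integral_linear[OF integrable_continuous[OF contq] bounded_linear_blinfun_inner_right]
    by (simp add: o_def)
  finally show ?thesis
    unfolding gderiv_def blinfun_inner_right.rep_eq inner_commute[of _ "integral (cbox a b) (D q)"]
    using at_within_open[of q "ball q e"] e(1) by simp
qed

definition newton_grad :: "real^3 \<Rightarrow> real^3" where
  "newton_grad r = - (1 / norm r ^ 3) *\<^sub>R r"

definition newton_hess :: "real^3 \<Rightarrow> real^3 \<Rightarrow> real^3" where
  "newton_hess r w = (3 * (r \<bullet> w) / norm r ^ 5) *\<^sub>R r - (1 / norm r ^ 3) *\<^sub>R w"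

lemma GDERIV_inverse_norm:
  fixes r :: "real^3"
  assumes "r \<noteq> 0"
  shows "GDERIV (\<lambda>r. 1 / norm r) r :> newton_grad r"
proof (rule GDERIV_subst)
  show "GDERIV (\<lambda>r. 1 / norm r) r :> - (inverse (norm r))\<^sup>2 *\<^sub>R sgn r"
    using GDERIV_inverse[OF GDERIV_norm] assms by (simp add: inverse_eq_divide)
  show "- (inverse (norm r))\<^sup>2 *\<^sub>R sgn r = newton_grad r"
    by (simp add: newton_grad_def sgn_div_norm eval_nat_numeral divide_simps)
qed

lemma GDERIV_inner_newton_grad:
  fixes r :: "real^3"
  assumes "r \<noteq> 0"
  shows "GDERIV (\<lambda>r. d \<bullet> newton_grad r) r :> newton_hess r d"
proof -
  have eq: "(\<lambda>r. d \<bullet> newton_grad r) = (\<lambda>r. - (d \<bullet> r) * (1 / norm r ^ 3))"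
    by (simp add: newton_grad_def fun_eq_iff)
  have lin: "GDERIV (\<lambda>r. - (d \<bullet> r)) r :> - d"
    unfolding gderiv_def by (auto intro!: derivative_eq_intros simp: inner_commute)
  have "DERIV (\<lambda>s. 1 / s ^ 3) (norm r) :> - 3 / norm r ^ 4"
    using assms
    by (auto intro!: derivative_eq_intros simp: divide_simps eval_nat_numeral)
  from GDERIV_mult[OF lin GDERIV_DERIV_compose[OF GDERIV_norm[OF assms] this]]
  show ?thesis
    unfolding eq
    by (rule GDERIV_subst)
      (use assms in \<open>simp_all add: newton_hess_def sgn_div_norm eval_nat_numeral inner_commute
        inverse_eq_divide mult_ac\<close>)
qed

lemma GDERIV_translate:
  assumes "GDERIV f (p - q) :> D"
  shows "GDERIV (\<lambda>p. f (p - q)) p :> D"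
proof -
  have "((\<lambda>p. p - q) has_derivative (\<lambda>h. h)) (at p)"
    by (auto intro!: derivative_eq_intros)
  from has_derivative_compose[OF this assms[unfolded gderiv_def]] show ?thesis
    unfolding gderiv_def .
qed

lemma GDERIV_reflect:
  assumes "GDERIV f (p - q) :> D"
  shows "GDERIV (\<lambda>q. f (p - q)) q :> - D"
proof -
  have "((\<lambda>q. p - q) has_derivative (\<lambda>h. - h)) (at q)"
    by (auto intro!: derivative_eq_intros)
  from has_derivative_compose[OF this assms[unfolded gderiv_def]] show ?thesis
    unfolding gderiv_def by simp
qed

lemma continuous_on_newton_grad [continuous_intros]:
  assumes "continuous_on S f" "\<And>z. z \<in> S \<Longrightarrow> f z \<noteq> 0"
  shows "continuous_on S (\<lambda>z. newton_grad (f z))"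
  unfolding newton_grad_def by (intro continuous_intros assms) (use assms in simp)

lemma continuous_on_newton_hess [continuous_intros]:
  assumes "continuous_on S f" "continuous_on S g" "\<And>z. z \<in> S \<Longrightarrow> f z \<noteq> 0"
  shows "continuous_on S (\<lambda>z. newton_hess (f z) (g z))"
  unfolding newton_hess_def by (intro continuous_intros assms) (use assms in simp_all)

text \<open>
  Harmonicity of the Newton kernel enters here: for an arbitrary symmetric bilinear form \<open>H\<close> the
  right-hand side exceeds the left-hand side by the trace of \<open>H\<close> times \<open>m \<bullet> (c \<times> d)\<close>.
\<close>

lemma newton_hess_cross:
  assumes "r \<noteq> 0"
  shows "- (newton_hess r m \<bullet> cross3 c d)
    = cross3 m c \<bullet> newton_hess r d - cross3 m d \<bullet> newton_hess r c"
proof -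
  \<comment> \<open>Factoring out the common power of the norm leaves an identity polynomial in the
    coordinates of the vectors.\<close>
  define k where "k = 1 / norm r ^ 5"
  have k3: "1 / norm r ^ 3 = k * (r \<bullet> r)"
    using assms by (simp add: k_def dot_square_norm eval_nat_numeral field_simps)
  have k5: "3 * (r \<bullet> w) / norm r ^ 5 = k * (3 * (r \<bullet> w))" for w
    by (simp add: k_def)
  have hess: "newton_hess r w = k *\<^sub>R ((3 * (r \<bullet> w)) *\<^sub>R r - (r \<bullet> r) *\<^sub>R w)" for w
    by (simp add: newton_hess_def k3 k5 scaleR_diff_right)
  have "- (((3 * (r \<bullet> m)) *\<^sub>R r - (r \<bullet> r) *\<^sub>R m) \<bullet> cross3 c d)
    = cross3 m c \<bullet> ((3 * (r \<bullet> d)) *\<^sub>R r - (r \<bullet> r) *\<^sub>R d)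
      - cross3 m d \<bullet> ((3 * (r \<bullet> c)) *\<^sub>R r - (r \<bullet> r) *\<^sub>R c)"
    by (simp add: cross3_simps)
  from arg_cong[OF this, of "(*) k"] show ?thesis
    unfolding hess inner_scaleR_left inner_scaleR_right by (simp only: Rings.right_diff_distrib mult_minus_right)
qed

section \<open>Potentials of triangles and edges\<close>

lemma closed_flat_triangle: "closed (flat_triangle x)"
  unfolding flat_triangle_def by (simp add: compact_imp_closed finite_imp_compact_convex_hull)

lemma grad_newton_kernel:
  assumes "p \<noteq> q"
  shows "grad (\<lambda>p. newton_kernel p q) p = newton_grad (p - q)"
  unfolding newton_kernel_def
  by (intro grad_eqI GDERIV_translate GDERIV_inverse_norm) (use assms in simp)

text \<open>Differentiation under the integral sign is available on boxes, hence the passage from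
  the simplex to the unit square.\<close>

lemma triangle_integral_square:
  assumes "continuous_on (flat_triangle x) f"
  shows "triangle_integral x f = integral (cbox (0, 0) (1, 1))
    (\<lambda>z. 2 * area x * (1 - fst z) * f (triangle_point x (fst z) ((1 - fst z) * snd z)))"
  unfolding triangle_integral_def integral_std_simplex_square[OF continuous_on_triangle_point[OF assms]]
  by (simp add: case_prod_unfold mult.assoc flip: integral_mult_right del: One_nat_def)

lemma square_triangle_point_mem:
  assumes "z \<in> cbox (0, 0) (1, 1)"
  shows "triangle_point x (fst z) ((1 - fst z) * snd z) \<in> flat_triangle x"
proof (rule triangle_point_mem)
  have "0 \<le> fst z" "fst z \<le> 1" "0 \<le> snd z" "snd z \<le> 1"
    using assms by (auto simp: cbox_Pair_eq)
  then show "(fst z, (1 - fst z) * snd z) \<in> std_simplex"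
    using mult_left_le[of "snd z" "1 - fst z"] by simp
qed

text \<open>Off the closed triangle the kernel is smooth, so the gradient in \<open>q\<close> may be
  taken under the integral; the dependence through \<open>p - q\<close> produces the minus sign.
  Pairing with \<open>w\<close> keeps integrands real, as \<open>triangle_integral\<close>
  requires.\<close>

lemma inner_grad_double_layer:
  assumes q: "q \<notin> flat_triangle x"
  shows "w \<bullet> grad (\<lambda>q'. triangle_integral x (\<lambda>p. m \<bullet> grad (\<lambda>p'. newton_kernel p' q') p)) q
    = triangle_integral x (\<lambda>p. - (newton_hess (p - q) m \<bullet> w))"
proof -
  define U where "U = - flat_triangle x"
  define P where "P = (\<lambda>z. triangle_point x (fst z) ((1 - fst z) * snd z))"
  define k where "k = (\<lambda>z::real \<times> real. 2 * area x * (1 - fst z))"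
  define D where "D = (\<lambda>q z. k z *\<^sub>R - newton_hess (P z - q) m)"
  have U: "open U" "q \<in> U"
    using q closed_flat_triangle by (auto simp: U_def)
  have P: "P z \<in> flat_triangle x" if "z \<in> cbox (0, 0) (1, 1)" for z
    unfolding P_def by (rule square_triangle_point_mem[OF that])
  have contP: "continuous_on A (\<lambda>z. P (f z))" if "continuous_on A f" for A :: "'b::topological_space set" and f
    unfolding P_def by (intro continuous_intros that)
  have contk: "continuous_on A (\<lambda>z. k (f z))" if "continuous_on A f" for A :: "'b::topological_space set" and f
    unfolding k_def by (intro continuous_intros that)
  have ne: "P z - q' \<noteq> 0" if "q' \<in> U" "z \<in> cbox (0, 0) (1, 1)" for q' z
    using P[OF that(2)] that(1) by (auto simp: U_def)
  have potential: "triangle_integral x (\<lambda>p. m \<bullet> grad (\<lambda>p'. newton_kernel p' q') p)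
      = integral (cbox (0, 0) (1, 1)) (\<lambda>z. k z * (m \<bullet> newton_grad (P z - q')))"
    if "q' \<in> U" for q'
  proof -
    have "triangle_integral x (\<lambda>p. m \<bullet> grad (\<lambda>p'. newton_kernel p' q') p)
        = triangle_integral x (\<lambda>p. m \<bullet> newton_grad (p - q'))"
      using that by (intro triangle_integral_cong arg_cong[of _ _ "inner m"] grad_newton_kernel)
        (auto simp: U_def)
    also have "\<dots> = integral (cbox (0, 0) (1, 1)) (\<lambda>z. k z * (m \<bullet> newton_grad (P z - q')))"
      unfolding k_def P_def
      by (intro triangle_integral_square continuous_intros) (use that in \<open>auto simp: U_def\<close>)
    finally show ?thesis .
  qed
  have "GDERIV (\<lambda>q. integral (cbox (0, 0) (1, 1)) (\<lambda>z. k z * (m \<bullet> newton_grad (P z - q)))) q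
      :> integral (cbox (0, 0) (1, 1)) (D q)"
  proof (rule GDERIV_integral[OF U])
    fix q' z assume *: "q' \<in> U" "z \<in> cbox (0, 0) (1::real, 1::real)"
    have "GDERIV (\<lambda>q. m \<bullet> newton_grad (P z - q)) q' :> - newton_hess (P z - q') m"
      by (rule GDERIV_reflect[OF GDERIV_inner_newton_grad[OF ne[OF *]]])
    from GDERIV_mult[OF GDERIV_const this]
    show "GDERIV (\<lambda>q. k z * (m \<bullet> newton_grad (P z - q))) q' :> D q' z"
      by (simp add: D_def)
  next
    fix q' assume "q' \<in> U"
    then show "continuous_on (cbox (0, 0) (1, 1)) (\<lambda>z. k z * (m \<bullet> newton_grad (P z - q')))"
      by (intro continuous_intros contP contk) (use ne in blast)
  next
    show "continuous_on (U \<times> cbox (0, 0) (1, 1)) (\<lambda>(q, z). D q z)"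
      unfolding D_def case_prod_unfold
      by (intro continuous_intros contP contk) (use ne in auto)
  qed
  \<comment> \<open>The formula \<open>potential\<close> holds off the triangle, on the open set
    \<open>U\<close> around \<open>q\<close>; this is enough to transfer the derivative at
    \<open>q\<close>.\<close>
  then have "GDERIV (\<lambda>q'. triangle_integral x (\<lambda>p. m \<bullet> grad (\<lambda>p'. newton_kernel p' q') p)) q
      :> integral (cbox (0, 0) (1, 1)) (D q)"
    unfolding gderiv_def
    by (rule has_derivative_transform_within_open[OF _ U]) (simp add: potential)
  from grad_eqI[OF this]
  have "w \<bullet> grad (\<lambda>q'. triangle_integral x (\<lambda>p. m \<bullet> grad (\<lambda>p'. newton_kernel p' q') p)) q
      = w \<bullet> integral (cbox (0, 0) (1, 1)) (D q)" by simp
  also have "\<dots> = integral (cbox (0, 0) (1, 1)) (\<lambda>z. w \<bullet> D q z)"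
  proof -
    have "D q integrable_on cbox (0, 0) (1, 1)"
      unfolding D_def
      by (intro integrable_continuous continuous_intros contP contk) (use ne[OF U(2)] in blast)
    from integral_linear[OF this bounded_linear_inner_right[of w]]
    show ?thesis by (simp add: o_def)
  qed
  also have "\<dots> = integral (cbox (0, 0) (1, 1)) (\<lambda>z. k z * - (newton_hess (P z - q) m \<bullet> w))"
    by (simp add: D_def inner_commute[of w])
  also have "\<dots> = triangle_integral x (\<lambda>p. - (newton_hess (p - q) m \<bullet> w))"
    unfolding k_def P_def
    by (intro triangle_integral_square[symmetric] continuous_intros) (use q in auto)
  finally show ?thesis .
qed

text \<open>Supplies the scalar field and its gradient for the second use of Stokes' theorem, on the
  other triangle.\<close>

lemma GDERIV_edge_potential:
  assumes i: "i \<in> {1..3}" and q: "q \<notin> flat_triangle x"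
  shows "GDERIV (\<lambda>q. integral {0..1} (\<lambda>s. newton_kernel (x i + s *\<^sub>R edge x i) q)) q
    :> integral {0..1} (\<lambda>s. - newton_grad (x i + s *\<^sub>R edge x i - q))"
proof -
  define U where "U = - flat_triangle x"
  have U: "open U" "q \<in> U"
    using q closed_flat_triangle by (auto simp: U_def)
  have ne: "x i + s *\<^sub>R edge x i - q' \<noteq> 0" if "q' \<in> U" "s \<in> cbox 0 1" for q' s
    using edge_point_mem[of s i x] i that by (auto simp: U_def)
  show ?thesis
    unfolding box_real(2)[symmetric]
  proof (rule GDERIV_integral[OF U])
    fix q' s assume *: "q' \<in> U" "s \<in> cbox (0::real) 1"
    show "GDERIV (newton_kernel (x i + s *\<^sub>R edge x i)) q' :> - newton_grad (x i + s *\<^sub>R edge x i - q')"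
      unfolding newton_kernel_def
      by (rule GDERIV_reflect[OF GDERIV_inverse_norm[OF ne[OF *]]])
  next
    fix q' assume "q' \<in> U"
    then show "continuous_on (cbox 0 1) (\<lambda>s. newton_kernel (x i + s *\<^sub>R edge x i) q')"
      unfolding newton_kernel_def
      by (intro continuous_intros) (use ne in auto)
  next
    show "continuous_on (U \<times> cbox 0 1) (\<lambda>(q, s). - newton_grad (x i + s *\<^sub>R edge x i - q))"
      unfolding case_prod_unfold
      by (intro continuous_intros) (use ne in auto)
  qed
qed

lemma continuous_on_edge_potential_gradient:
  assumes i: "i \<in> {1..3}"
  shows "continuous_on (- flat_triangle x)
    (\<lambda>q. integral {0..1} (\<lambda>s. - newton_grad (x i + s *\<^sub>R edge x i - q)))"
  unfolding box_real(2)[symmetric]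
proof (rule integral_continuous_on_param)
  have "x i + s *\<^sub>R edge x i - q' \<noteq> 0" if "q' \<in> - flat_triangle x" "s \<in> cbox 0 1" for q' s
    using edge_point_mem[of s i x] i that by auto
  then show "continuous_on ((- flat_triangle x) \<times> cbox 0 1)
      (\<lambda>(q, s). - newton_grad (x i + s *\<^sub>R edge x i - q))"
    unfolding case_prod_unfold by (intro continuous_intros) auto
qed

section \<open>Reduction to edge integrals\<close>

lemma area_pos:
  assumes "\<not> collinear {x 1, x 2, x 3}"
  shows "0 < area x"
proof -
  have "{x 1, x 2, x 3} = {x 2, x 1, x 3}" by auto
  with assms have "\<not> collinear {0, x 2 - x 1, x 3 - x 1}"
    \<comment> \<open>\<open>collinear_3\<close> translates the middle point to the origin, hence
      the reordering of the vertices.\<close>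
    using collinear_3[of "x 2" "x 1" "x 3"] collinear_alt by auto
  then show ?thesis
    by (simp add: area_def cross_eq_0)
qed

lemma edge_nonzero:
  assumes "\<not> collinear {x 1, x 2, x 3}" "i \<in> {1..3}"
  shows "edge x i \<noteq> 0"
proof -
  have "i = 1 \<or> i = 2 \<or> i = 3" using assms(2) by auto
  moreover have "x 2 \<noteq> x 1" "x 3 \<noteq> x 2" "x 1 \<noteq> x 3"
    using assms(1) by (auto simp: insert_commute)
  ultimately show ?thesis
    by (elim disjE) (simp_all add: edge_1_2_3 del: One_nat_def)
qed

lemma edge_points_distinct:
  assumes "i \<in> {1..3}" "j \<in> {1..3}" "flat_triangle x \<inter> flat_triangle y = {}"
    and "s \<in> {0..1}" "t \<in> {0..1}"
  shows "x i + s *\<^sub>R edge x i \<noteq> y j + t *\<^sub>R edge y j"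
  using edge_point_mem[OF assms(4,1), of x] edge_point_mem[OF assms(5,2), of y] assms(3) by auto

text \<open>The first use of Stokes' theorem. The result is arranged as the integrand of
  \<open>triangle_stokes\<close> on \<open>y\<close>, with the constant vector
  \<open>edge x i\<close>. The proof works with \<open>cross3 c d\<close> in place of the normal,
  because \<open>newton_hess_cross\<close> splits a cross product; the positive area is cancelled at
  the end.\<close>

lemma normal_grad_double_layer:
  fixes x y :: "nat \<Rightarrow> real^3"
  assumes ncol: "\<not> collinear {y 1, y 2, y 3}" and q: "q \<notin> flat_triangle x"
  shows "normal y \<bullet> grad (\<lambda>q'. triangle_integral x (\<lambda>p. normal x \<bullet> grad (\<lambda>p'. newton_kernel p' q') p)) q
    = (\<Sum>i=1..3. cross3 (normal y) (edge x i)
        \<bullet> integral {0..1} (\<lambda>s. - newton_grad (x i + s *\<^sub>R edge x i - q)))"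
proof -
  define c d where "c = y 2 - y 1" and "d = y 3 - y 1"
  define G where "G i = integral {0..1} (\<lambda>s. - newton_grad (x i + s *\<^sub>R edge x i - q))" for i
  let ?W = "grad (\<lambda>q'. triangle_integral x (\<lambda>p. normal x \<bullet> grad (\<lambda>p'. newton_kernel p' q') p)) q"
  have n: "cross3 c d = (2 * area y) *\<^sub>R normal y"
    by (simp only: c_def d_def double_area_normal)
  have ne: "p - q \<noteq> 0" if "p \<in> flat_triangle x" for p
    using that q by auto
  have der: "GDERIV (\<lambda>p. w \<bullet> newton_grad (p - q)) p :> newton_hess (p - q) w"
    if "p \<in> flat_triangle x" for p w
    by (intro GDERIV_translate GDERIV_inner_newton_grad ne that)
  have cont: "continuous_on (flat_triangle x) (\<lambda>p. newton_hess (p - q) w)" for w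
    by (intro continuous_intros) (rule ne)
  have G: "w \<bullet> G i = - integral {0..1} (\<lambda>s. w \<bullet> newton_grad (x i + s *\<^sub>R edge x i - q))"
    if "i \<in> {1..3}" for i w
  proof -
    have "x i + s *\<^sub>R edge x i - q \<noteq> 0" if "s \<in> {0..1}" for s
      by (rule ne[OF edge_point_mem[OF that \<open>i \<in> {1..3}\<close>]])
    then have "(\<lambda>s. - newton_grad (x i + s *\<^sub>R edge x i - q)) integrable_on {0..1}"
      by (intro integrable_continuous_real continuous_intros) blast
    from integral_linear[OF this bounded_linear_inner_right[of w]]
    show ?thesis by (simp add: o_def G_def)
  qed
  have "cross3 c d \<bullet> ?W = triangle_integral x (\<lambda>p. - (newton_hess (p - q) (normal x) \<bullet> cross3 c d))"
    by (rule inner_grad_double_layer[OF q])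
  also have "\<dots> = triangle_integral x (\<lambda>p. cross3 (normal x) c \<bullet> newton_hess (p - q) d
      - cross3 (normal x) d \<bullet> newton_hess (p - q) c)"
    by (intro triangle_integral_cong newton_hess_cross ne)
  also have "\<dots> = triangle_integral x (\<lambda>p. cross3 (normal x) c \<bullet> newton_hess (p - q) d)
      - triangle_integral x (\<lambda>p. cross3 (normal x) d \<bullet> newton_hess (p - q) c)"
    by (intro triangle_integral_diff continuous_on_inner continuous_on_const cont)
  also have "triangle_integral x (\<lambda>p. cross3 (normal x) c \<bullet> newton_hess (p - q) d)
      = - (\<Sum>i=1..3. (edge x i \<bullet> c) * integral {0..1} (\<lambda>s. d \<bullet> newton_grad (x i + s *\<^sub>R edge x i - q)))"
    by (rule triangle_stokes[OF der cont])
  also have "triangle_integral x (\<lambda>p. cross3 (normal x) d \<bullet> newton_hess (p - q) c)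
      = - (\<Sum>i=1..3. (edge x i \<bullet> d) * integral {0..1} (\<lambda>s. c \<bullet> newton_grad (x i + s *\<^sub>R edge x i - q)))"
    by (rule triangle_stokes[OF der cont])
  also have "- (\<Sum>i=1..3. (edge x i \<bullet> c) * integral {0..1} (\<lambda>s. d \<bullet> newton_grad (x i + s *\<^sub>R edge x i - q)))
      - - (\<Sum>i=1..3. (edge x i \<bullet> d) * integral {0..1} (\<lambda>s. c \<bullet> newton_grad (x i + s *\<^sub>R edge x i - q)))
    = (\<Sum>i=1..3. (edge x i \<bullet> c) * (d \<bullet> G i) - (edge x i \<bullet> d) * (c \<bullet> G i))"
    by (simp add: G sum_subtractf sum_negf)
  \<comment> \<open>The triple product read backwards: (l . c) d - (l . d) c = (c x d) x l for each
    edge l.\<close>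
  also have "\<dots> = (\<Sum>i=1..3. cross3 (cross3 c d) (edge x i) \<bullet> G i)"
    by (intro sum.cong refl) (simp add: cross3_simps)
  also have "\<dots> = 2 * area y * (\<Sum>i=1..3. cross3 (normal y) (edge x i) \<bullet> G i)"
    by (simp add: n cross_mult_left sum_distrib_left)
  finally have "2 * area y * (normal y \<bullet> ?W) = 2 * area y * (\<Sum>i=1..3. cross3 (normal y) (edge x i) \<bullet> G i)"
    by (simp add: n)
  with area_pos[OF ncol] show ?thesis
    by (simp add: G_def)
qed

text \<open>The second use of Stokes' theorem leaves the edge of \<open>x\<close> as the inner
  integration, whereas \<open>edge_integral\<close> has it outside. Disjointness makes the integrand
  continuous, so the order may be exchanged.\<close>

lemma edge_integral_eq:
  assumes ij: "i \<in> {1..3}" "j \<in> {1..3}" and disj: "flat_triangle x \<inter> flat_triangle y = {}"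
  shows "edge_integral x y i j = norm (edge x i) * norm (edge y j) *
    integral {0..1} (\<lambda>t. integral {0..1} (\<lambda>s. newton_kernel (x i + s *\<^sub>R edge x i) (y j + t *\<^sub>R edge y j)))"
proof -
  have ne: "x i + s *\<^sub>R edge x i - (y j + t *\<^sub>R edge y j) \<noteq> 0" if "s \<in> {0..1}" "t \<in> {0..1}" for s t
    using edge_points_distinct[OF ij disj that] by simp
  have "continuous_on (cbox (0, 0) (1, 1))
      (\<lambda>(s, t). newton_kernel (x i + s *\<^sub>R edge x i) (y j + t *\<^sub>R edge y j))"
    unfolding newton_kernel_def case_prod_unfold
    by (intro continuous_intros) (use ne in \<open>auto simp: cbox_Pair_eq\<close>)
  note swap = integral_swap_continuous[OF this, unfolded box_real]
  have eq: "s *\<^sub>R edge x i - t *\<^sub>R edge y j + x i - y j = x i + s *\<^sub>R edge x i - (y j + t *\<^sub>R edge y j)" for s t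
    by simp
  show ?thesis
    unfolding edge_integral_def eq using swap by (simp add: newton_kernel_def)
qed

lemma double_layer_flux:
  fixes x y :: "nat \<Rightarrow> real^3"
  assumes colx: "\<not> collinear {x 1, x 2, x 3}" and coly: "\<not> collinear {y 1, y 2, y 3}"
    and disj: "flat_triangle x \<inter> flat_triangle y = {}"
  shows "triangle_integral y (\<lambda>q. normal y \<bullet>
            grad (\<lambda>q'. triangle_integral x (\<lambda>p. normal x \<bullet> grad (\<lambda>p'. newton_kernel p' q') p)) q)
         = - (\<Sum>i=1..3. \<Sum>j=1..3.
               (edge x i \<bullet> edge y j) / (norm (edge x i) * norm (edge y j)) * edge_integral x y i j)"
proof -
  define G where "G i q = integral {0..1} (\<lambda>s. - newton_grad (x i + s *\<^sub>R edge x i - q))" for i q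
  define V where "V i q = integral {0..1} (\<lambda>s. newton_kernel (x i + s *\<^sub>R edge x i) q)" for i q
  have qx: "q \<notin> flat_triangle x" if "q \<in> flat_triangle y" for q
    using that disj by auto
  have cont: "continuous_on (flat_triangle y) (G i)" if "i \<in> {1..3}" for i
    unfolding G_def
    by (rule continuous_on_subset[OF continuous_on_edge_potential_gradient[OF that]]) (use qx in blast)
  have der: "GDERIV (V i) q :> G i q" if "i \<in> {1..3}" "q \<in> flat_triangle y" for i q
    unfolding V_def G_def by (intro GDERIV_edge_potential qx that)
  have "triangle_integral y (\<lambda>q. normal y \<bullet>
      grad (\<lambda>q'. triangle_integral x (\<lambda>p. normal x \<bullet> grad (\<lambda>p'. newton_kernel p' q') p)) q)
    = triangle_integral y (\<lambda>q. \<Sum>i=1..3. cross3 (normal y) (edge x i) \<bullet> G i q)"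
    unfolding G_def by (intro triangle_integral_cong normal_grad_double_layer[OF coly qx])
  also have "\<dots> = (\<Sum>i=1..3. triangle_integral y (\<lambda>q. cross3 (normal y) (edge x i) \<bullet> G i q))"
    by (intro triangle_integral_sum continuous_on_inner continuous_on_const cont) auto
  \<comment> \<open>Stokes' theorem on \<open>y\<close> for the field \<open>V i\<close> times the
    constant vector \<open>edge x i\<close>.\<close>
  also have "\<dots> = (\<Sum>i=1..3. - (\<Sum>j=1..3. (edge y j \<bullet> edge x i)
      * integral {0..1} (\<lambda>t. V i (y j + t *\<^sub>R edge y j))))"
    by (intro sum.cong refl triangle_stokes cont der)
  also have "\<dots> = (\<Sum>i=1..3. - (\<Sum>j=1..3.
      (edge x i \<bullet> edge y j) / (norm (edge x i) * norm (edge y j)) * edge_integral x y i j))"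
  proof (intro sum.cong refl arg_cong[of _ _ uminus])
    fix i j :: nat assume ij: "i \<in> {1..3}" "j \<in> {1..3}"
    show "(edge y j \<bullet> edge x i) * integral {0..1} (\<lambda>t. V i (y j + t *\<^sub>R edge y j))
      = (edge x i \<bullet> edge y j) / (norm (edge x i) * norm (edge y j)) * edge_integral x y i j"
      unfolding edge_integral_eq[OF ij disj] V_def
      using edge_nonzero[OF colx ij(1)] edge_nonzero[OF coly ij(2)] by (simp add: inner_commute)
  qed
  finally show ?thesis by (simp add: sum_negf)
qed

section \<open>Orthogonal projections and heights\<close>

text \<open>The difference of two candidates lies in the span and is orthogonal to itself, so
  \<open>THE\<close> in \<open>par\<close> is determined.\<close>

lemma par_eqI:
  assumes "p \<in> span A" "\<And>w. w \<in> span A \<Longrightarrow> orthogonal (e - p) w"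
  shows "par A e = p"
  unfolding par_def
proof (rule the_equality)
  fix p' assume p': "p' \<in> span A \<and> (\<forall>w\<in>span A. orthogonal (e - p') w)"
  then have "p - p' \<in> span A"
    using assms(1) by (simp add: span_diff)
  with assms(2) p' have "orthogonal (e - p) (p - p')" "orthogonal (e - p') (p - p')"
    by blast+
  then have "(p - p') \<bullet> (p - p') = 0"
    by (simp add: orthogonal_def inner_diff_left inner_diff_right)
  then show "p' = p" by simp
qed (use assms in blast)

lemma par_mem: "par A e \<in> span A"
  and orthogonal_par: "w \<in> span A \<Longrightarrow> orthogonal (e - par A e) w"
proof -
  obtain p z where p: "p \<in> span A" "\<And>w. w \<in> span A \<Longrightarrow> orthogonal z w" "e = p + z"
    using orthogonal_subspace_decomp_exists[of A e] by blast
  then have "par A e = p" by (intro par_eqI) auto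
  with p show "par A e \<in> span A" "w \<in> span A \<Longrightarrow> orthogonal (e - par A e) w" by auto
qed

text \<open>Pythagoras: moving within the span changes only the component in the span, and the
  height stays constant.\<close>

lemma norm_add_height:
  assumes "w \<in> span A"
  shows "(norm (w + e))\<^sup>2 = (norm (w + par A e))\<^sup>2 + (height A e)\<^sup>2"
proof -
  have "w + par A e \<in> span A"
    by (intro span_add assms par_mem)
  then have "orthogonal (w + par A e) (e - par A e)"
    using orthogonal_par orthogonal_commute by blast
  from norm_add_Pythagorean[OF this] show ?thesis
    by (simp add: height_def)
qed

text \<open>Serves to exclude the unspecified case \<open>h1 = h2 = 0\<close> of
  \<open>Fhat1\<close>: for independent \<open>a\<close> and \<open>b\<close>, a vector with nonzero
  \<open>a\<close>-coefficient is off the line spanned by \<open>b\<close>.\<close>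

lemma height_singleton_ne_0:
  assumes "\<not> collinear {0, a, b}" "c \<noteq> 0"
  shows "height {b} (c *\<^sub>R a + d *\<^sub>R b) \<noteq> 0"
proof
  assume "height {b} (c *\<^sub>R a + d *\<^sub>R b) = 0"
  then have "c *\<^sub>R a + d *\<^sub>R b \<in> span {b}"
    using par_mem[of "{b}" "c *\<^sub>R a + d *\<^sub>R b"] by (simp add: height_def)
  then obtain k where "c *\<^sub>R a + d *\<^sub>R b = k *\<^sub>R b"
    by (auto simp: span_singleton)
  then have "c *\<^sub>R a = (k - d) *\<^sub>R b"
    by (simp add: algebra_simps)
  then have "a = ((k - d) / c) *\<^sub>R b"
    using assms(2) by (metis divideR_right divide_inverse_commute scaleR_scaleR)
  moreover have "\<not> collinear {0, b, a}"
    using assms(1) by (simp add: insert_commute)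
  ultimately show False
    by (auto simp: collinear_lemma)
qed

section \<open>The one-dimensional integral\<close>

text \<open>
  The odd extension of \<open>P * Fhat1 h1 h2 P\<close> to negative \<open>P\<close>: a primitive that also covers edges on
  which the foot of the perpendicular lies.
\<close>

definition Lhat :: "real \<Rightarrow> real \<Rightarrow> real \<Rightarrow> real" where
  "Lhat h1 h2 P =
     (let h = sqrt (h1\<^sup>2 + h2\<^sup>2); R = sqrt (P\<^sup>2 + h\<^sup>2) in
      arsinh (P / h) - (if h1 = 0 then P / (R + h2) else h2 / h1 * arctan (h1 * P / (h\<^sup>2 + R * h2))))"

lemma Lhat_minus: "Lhat h1 h2 (- P) = - Lhat h1 h2 P"
  by (simp add: Lhat_def Let_def arctan_minus)

text \<open>The logarithm of (P + R) / h is arsinh (P / h), since the square root of (P / h)^2 + 1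
  is R / h.\<close>

lemma Lhat_eq_Fhat1:
  assumes "h1 \<noteq> 0 \<or> h2 \<noteq> 0" "0 < P"
  shows "Lhat h1 h2 P = P * Fhat1 h1 h2 P"
proof -
  define h where "h = sqrt (h1\<^sup>2 + h2\<^sup>2)"
  have h: "0 < h" using assms(1) by (auto simp: h_def sum_power2_gt_zero_iff)
  have "sqrt ((P / h)\<^sup>2 + 1) = sqrt (P\<^sup>2 + h\<^sup>2) / h"
  proof -
    have "(P / h)\<^sup>2 + 1 = (P\<^sup>2 + h\<^sup>2) / h\<^sup>2" using h by (simp add: field_simps)
    then show ?thesis using h by (simp add: real_sqrt_divide)
  qed
  then have "arsinh (P / h) = ln ((P + sqrt (P\<^sup>2 + h\<^sup>2)) / h)"
    by (simp add: arsinh_real_def add_divide_distrib)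
  then show ?thesis
    using assms unfolding Lhat_def Fhat1_def Let_def h_def[symmetric]
    by (auto simp: Rings.right_diff_distrib)
qed

text \<open>Along a line at distance \<open>h1\<close> from the origin, with \<open>P\<close>
  measured from the foot of the perpendicular, this derivative is the boundary density
  \<open>1 / (N + h2)\<close> of the two-dimensional problem.\<close>

lemma DERIV_Lhat:
  assumes ne: "h1 \<noteq> 0 \<or> h2 \<noteq> 0" and h2: "0 \<le> h2"
  shows "(Lhat h1 h2 has_real_derivative 1 / (sqrt (P\<^sup>2 + (h1\<^sup>2 + h2\<^sup>2)) + h2)) (at P)"
proof -
  define h where "h = sqrt (h1\<^sup>2 + h2\<^sup>2)"
  define R where "R = sqrt (P\<^sup>2 + h\<^sup>2)"
  have h: "0 < h" using ne by (auto simp: h_def sum_power2_gt_zero_iff)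
  have hh: "h\<^sup>2 = h1\<^sup>2 + h2\<^sup>2" by (simp add: h_def)
  have RR: "R\<^sup>2 = P\<^sup>2 + h\<^sup>2" by (simp add: R_def)
  have R: "0 < R" using h by (simp add: R_def sum_power2_gt_zero_iff)
  have R2: "0 < R + h2" using R h2 by simp
  have D: "0 < h\<^sup>2 + R * h2" using h R h2 by (simp add: add_pos_nonneg)
  have dR: "((\<lambda>P. sqrt (P\<^sup>2 + h\<^sup>2)) has_real_derivative P / R) (at P)"
  proof -
    have "0 < P\<^sup>2 + h\<^sup>2" using h by (simp add: add_nonneg_pos)
    then show ?thesis
      unfolding R_def by (auto intro!: derivative_eq_intros simp: divide_simps)
  qed
  have da: "((\<lambda>P. arsinh (P / h)) has_real_derivative 1 / R) (at P)"
  proof -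
    have "sqrt ((P / h)\<^sup>2 + 1) * h = R"
    proof -
      have "(P / h)\<^sup>2 + 1 = (P\<^sup>2 + h\<^sup>2) / h\<^sup>2" using h by (simp add: field_simps)
      then show ?thesis using h by (simp add: real_sqrt_divide R_def)
    qed
    moreover have "((\<lambda>P. arsinh (P / h)) has_real_derivative 1 / sqrt ((P / h)\<^sup>2 + 1) * (1 / h)) (at P)"
      by (rule DERIV_chain2[OF arsinh_real_has_field_derivative])
        (use h in \<open>auto intro!: derivative_eq_intros\<close>)
    ultimately show ?thesis by (simp add: field_simps)
  qed
  show ?thesis
  proof (cases "h1 = 0")
    case True
    then have hh2: "h = h2" using h2 by (simp add: h_def)
    have L: "Lhat h1 h2 = (\<lambda>P. arsinh (P / h) - P / (sqrt (P\<^sup>2 + h\<^sup>2) + h2))"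
      using True by (simp add: Lhat_def h_def fun_eq_iff)
    have "(Lhat h1 h2 has_real_derivative 1 / R - (1 * (R + h2) - P * (P / R)) / ((R + h2) * (R + h2))) (at P)"
    proof -
      have "((\<lambda>P. sqrt (P\<^sup>2 + h\<^sup>2) + h2) has_real_derivative P / R) (at P)"
        using DERIV_add[OF dR DERIV_const] by simp
      from DERIV_diff[OF da DERIV_divide[OF DERIV_ident this]] show ?thesis
        unfolding L using R2 by (simp add: R_def)
    qed
    moreover have "1 / R - (1 * (R + h2) - P * (P / R)) / ((R + h2) * (R + h2)) = 1 / (R + h2)"
    proof -
      \<comment> \<open>Here \<open>h = h2\<close>, so P^2 = (R - h2) (R + h2) and a factor
        \<open>R + h2\<close> cancels.\<close>
      have "P * P = R * R - h2 * h2" using RR hh2 by (simp add: power2_eq_square)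
      then have *: "P * (P / R) = (R * R - h2 * h2) / R" by simp
      show ?thesis unfolding * using R R2 by (simp add: divide_simps) (simp add: algebra_simps)
    qed
    ultimately show ?thesis by (simp add: R_def hh)
  next
    case False
    define D where "D = h\<^sup>2 + R * h2"
    have L: "Lhat h1 h2 = (\<lambda>P. arsinh (P / h) - h2 / h1 * arctan (h1 * P / (h\<^sup>2 + sqrt (P\<^sup>2 + h\<^sup>2) * h2)))"
      using False by (simp add: Lhat_def h_def fun_eq_iff)
    have dq: "((\<lambda>P. h1 * P / (h\<^sup>2 + sqrt (P\<^sup>2 + h\<^sup>2) * h2)) has_real_derivative
        (h1 * D - h1 * P * (P / R * h2)) / (D * D)) (at P)"
    proof -
      have "((\<lambda>P. h1 * P) has_real_derivative h1) (at P)"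
        using DERIV_cmult[OF DERIV_ident, of h1] by simp
      moreover have "((\<lambda>P. h\<^sup>2 + sqrt (P\<^sup>2 + h\<^sup>2) * h2) has_real_derivative P / R * h2) (at P)"
        using DERIV_add[OF DERIV_const DERIV_cmult_right[OF dR]] by simp
      ultimately show ?thesis
        unfolding D_def R_def
        by (rule DERIV_divide) (use \<open>0 < h\<^sup>2 + R * h2\<close> in \<open>simp add: R_def\<close>)
    qed
    have "(Lhat h1 h2 has_real_derivative
        1 / R - h2 / h1 * (inverse (1 + (h1 * P / D)\<^sup>2) * ((h1 * D - h1 * P * (P / R * h2)) / (D * D)))) (at P)"
      unfolding L
      using DERIV_diff[OF da DERIV_cmult[OF DERIV_chain2[OF DERIV_arctan dq]]]
      by (simp only: D_def R_def)
    moreover have "1 / R - h2 / h1 * (inverse (1 + (h1 * P / D)\<^sup>2) * ((h1 * D - h1 * P * (P / R * h2)) / (D * D)))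
        = 1 / (R + h2)"
    proof -
      have D0: "0 < D" using \<open>0 < h\<^sup>2 + R * h2\<close> by (simp add: D_def)
      have PP: "P\<^sup>2 = R\<^sup>2 - h\<^sup>2" using RR by simp
      have h1: "h1\<^sup>2 = h\<^sup>2 - h2\<^sup>2" using hh by simp
      \<comment> \<open>Eliminating \<open>P\<close> and \<open>h1\<close> through R^2 = P^2 + h^2
        and h^2 = h1^2 + h2^2 turns the denominator from the arctangent into a perfect
        square.\<close>
      have sq: "D\<^sup>2 + h1\<^sup>2 * P\<^sup>2 = h\<^sup>2 * (R + h2)\<^sup>2"
        unfolding h1 PP D_def by (simp add: power2_eq_square algebra_simps)
      have "1 + (h1 * P / D)\<^sup>2 = (D\<^sup>2 + h1\<^sup>2 * P\<^sup>2) / D\<^sup>2"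
        using D0 by (simp add: power_divide power_mult_distrib field_simps)
      also have "\<dots> = h\<^sup>2 * (R + h2)\<^sup>2 / D\<^sup>2" unfolding sq ..
      finally have 1: "inverse (1 + (h1 * P / D)\<^sup>2) = D\<^sup>2 / (h\<^sup>2 * (R + h2)\<^sup>2)"
        by simp
      have "h1 * D - h1 * P * (P / R * h2) = h1 * (R * D - P\<^sup>2 * h2) / R"
        using R by (simp add: field_simps power2_eq_square)
      \<comment> \<open>The numerator contains the same factor \<open>h\<^sup>2 * (R + h2)\<close>,
        so the arctangent term contributes h2 / (R (R + h2)), and 1 / R minus this is 1 / (R +
        h2).\<close>
      also have "R * D - P\<^sup>2 * h2 = h\<^sup>2 * (R + h2)"
        unfolding PP D_def by (simp add: power2_eq_square algebra_simps)
      finally have 2: "h1 * D - h1 * P * (P / R * h2) = h1 * (h\<^sup>2 * (R + h2)) / R" .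
      have 3: "h2 / h1 * (D\<^sup>2 / (h\<^sup>2 * q\<^sup>2) * (h1 * (h\<^sup>2 * q) / R / (D * D))) = h2 / (R * q)"
        if "q \<noteq> 0" for q
        using that False D0 h R by (simp add: field_simps power2_eq_square)
      show ?thesis
        unfolding 1 2 3[OF less_imp_neq[OF R2, symmetric]] using R R2 by (simp add: divide_simps)
    qed
    ultimately show ?thesis by (simp add: R_def hh)
  qed
qed

text \<open>With P = (t + s) |a|, the signed distance from the foot of the perpendicular, |t a +
  e|^2 = P^2 + h1^2. Hence \<open>Lhat\<close> divided by |a| is a primitive in
  \<open>t\<close>.\<close>

lemma Ihat1_eq_integral:
  fixes a :: "'a::euclidean_space"
  assumes a: "a \<noteq> 0" and h2: "0 \<le> h2" and ne: "height {a} e \<noteq> 0 \<or> h2 \<noteq> 0"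
  shows "Ihat1 h2 a e = integral {0..1} (\<lambda>t. 1 / (sqrt ((norm (t *\<^sub>R a + e))\<^sup>2 + h2\<^sup>2) + h2))"
proof -
  define s where "s = (SOME s. par {a} e = s *\<^sub>R a)"
  define h1 where "h1 = height {a} e"
  have par: "par {a} e = s *\<^sub>R a"
    unfolding s_def by (rule someI_ex) (use par_mem[of "{a}" e] in \<open>auto simp: span_singleton\<close>)
  have na: "0 < norm a" using a by simp
  have norm: "(norm (t *\<^sub>R a + e))\<^sup>2 = ((t + s) * norm a)\<^sup>2 + h1\<^sup>2" for t
    using norm_add_height[of "t *\<^sub>R a" "{a}" e]
    by (simp add: par h1_def span_base span_scale power_mult_distrib flip: scaleR_add_left)
  \<comment> \<open>Oddness of \<open>Lhat\<close> absorbs the absolute value for negative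
    \<open>c\<close>. At \<open>c = 0\<close> it gives the value 0, matching the omitted
    term.\<close>
  have term_eq: "c * Fhat1 h1 h2 (\<bar>c\<bar> * norm a) = Lhat h1 h2 (c * norm a) / norm a" for c
  proof (cases "c = 0")
    case True
    then show ?thesis using Lhat_minus[of h1 h2 0] by simp
  next
    case False
    then have "Lhat h1 h2 (\<bar>c\<bar> * norm a) = \<bar>c\<bar> * norm a * Fhat1 h1 h2 (\<bar>c\<bar> * norm a)"
      using ne na by (intro Lhat_eq_Fhat1) (auto simp: h1_def)
    then show ?thesis
      using na Lhat_minus[of h1 h2 "c * norm a"] by (auto simp: abs_if field_simps split: if_splits)
  qed
  have "((\<lambda>t. 1 / (sqrt ((norm (t *\<^sub>R a + e))\<^sup>2 + h2\<^sup>2) + h2)) has_integral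
      Lhat h1 h2 ((1 + s) * norm a) / norm a - Lhat h1 h2 ((0 + s) * norm a) / norm a) {0..1}"
  proof (rule fundamental_theorem_of_calculus)
    fix t :: real
    have "((\<lambda>t. Lhat h1 h2 ((t + s) * norm a)) has_real_derivative
        1 / (sqrt (((t + s) * norm a)\<^sup>2 + (h1\<^sup>2 + h2\<^sup>2)) + h2) * norm a) (at t within {0..1})"
      by (rule DERIV_chain2[OF DERIV_Lhat])
        (use ne h2 in \<open>auto simp: h1_def intro!: derivative_eq_intros\<close>)
    from DERIV_cdivide[OF this, of "norm a"]
    show "((\<lambda>t. Lhat h1 h2 ((t + s) * norm a) / norm a) has_vector_derivative
        1 / (sqrt ((norm (t *\<^sub>R a + e))\<^sup>2 + h2\<^sup>2) + h2)) (at t within {0..1})"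
      using na by (simp add: norm add.assoc has_real_derivative_iff_has_vector_derivative)
  qed simp
  from integral_unique[OF this] show ?thesis
    unfolding Ihat1_def Let_def s_def[symmetric] h1_def[symmetric] term_eq by simp
qed

section \<open>The closed form\<close>

text \<open>The inner integrand is the \<open>t\<close>-derivative of (t + s) / (N + h), one summand
  of the divergence; integrating it leaves the sides \<open>t = 1\<close> and \<open>t = 0\<close>
  of the square.\<close>

lemma integral_partial_term:
  fixes a b e :: "'a::euclidean_space"
  assumes ne: "\<And>t r. t \<in> {0..1} \<Longrightarrow> r \<in> {0..1} \<Longrightarrow> t *\<^sub>R a + r *\<^sub>R b + e \<noteq> 0"
    and h: "0 \<le> h"
  defines "N \<equiv> \<lambda>t r. norm (t *\<^sub>R a + r *\<^sub>R b + e)"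
  shows "integral {0..1} (\<lambda>r. integral {0..1} (\<lambda>t.
      1 / (N t r + h) - (t + s) * ((t *\<^sub>R a + r *\<^sub>R b + e) \<bullet> a) / (N t r * (N t r + h)\<^sup>2)))
    = (1 + s) * integral {0..1} (\<lambda>r. 1 / (N 1 r + h)) - s * integral {0..1} (\<lambda>r. 1 / (N 0 r + h))"
proof -
  have N: "0 < N t r" if "t \<in> {0..1}" "r \<in> {0..1}" for t r
    using ne[OF that] by (simp add: N_def)
  have "integral {0..1} (\<lambda>t. 1 / (N t r + h)
        - (t + s) * ((t *\<^sub>R a + r *\<^sub>R b + e) \<bullet> a) / (N t r * (N t r + h)\<^sup>2))
      = (1 + s) * (1 / (N 1 r + h)) - (0 + s) * (1 / (N 0 r + h))" if r: "r \<in> {0..1}" for r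
  proof (intro integral_unique fundamental_theorem_of_calculus)
    fix t :: real assume t: "t \<in> {0..1}"
    define v where "v = t *\<^sub>R a + r *\<^sub>R b + e"
    have v: "v \<noteq> 0" using ne[OF t r] by (simp add: v_def)
    have eq: "t *\<^sub>R a + r *\<^sub>R b + e = (r *\<^sub>R b + e) + t *\<^sub>R a" for t
      by simp
    have dN: "((\<lambda>t. N t r) has_real_derivative a \<bullet> sgn v) (at t)"
      unfolding N_def eq
      by (rule GDERIV_along_line) (use GDERIV_norm[OF v] in \<open>simp add: v_def eq\<close>)
    have Nt: "N t r = norm v" by (simp add: N_def v_def)
    have "((\<lambda>t. (t + s) * (1 / (N t r + h))) has_real_derivative
        1 / (N t r + h) - (t + s) * (v \<bullet> a) / (N t r * (N t r + h)\<^sup>2)) (at t)"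
    proof (rule DERIV_cong)
      have "((\<lambda>t. N t r + h) has_real_derivative a \<bullet> sgn v + 0) (at t)"
        by (rule DERIV_add[OF dN DERIV_const])
      moreover have nz: "N t r + h \<noteq> 0" "N t r \<noteq> 0"
        using N[OF t r] h by auto
      ultimately show "((\<lambda>t. (t + s) * (1 / (N t r + h))) has_real_derivative
          (1 + 0) * (1 / (N t r + h))
          + (0 * (N t r + h) - 1 * (a \<bullet> sgn v + 0)) / ((N t r + h) * (N t r + h)) * (t + s)) (at t)"
        by (intro DERIV_mult[OF DERIV_add[OF DERIV_ident DERIV_const]] DERIV_divide[OF DERIV_const])
      show "(1 + 0) * (1 / (N t r + h))
          + (0 * (N t r + h) - 1 * (a \<bullet> sgn v + 0)) / ((N t r + h) * (N t r + h)) * (t + s)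
        = 1 / (N t r + h) - (t + s) * (v \<bullet> a) / (N t r * (N t r + h)\<^sup>2)"
        using nz by (simp add: sgn_div_norm Nt inner_commute[of a] power2_eq_square divide_simps)
    qed
    then show "((\<lambda>t. (t + s) * (1 / (N t r + h))) has_vector_derivative
        1 / (N t r + h) - (t + s) * ((t *\<^sub>R a + r *\<^sub>R b + e) \<bullet> a) / (N t r * (N t r + h)\<^sup>2))
        (at t within {0..1})"
      unfolding v_def has_real_derivative_iff_has_vector_derivative
      by (rule has_vector_derivative_at_within)
  qed simp
  then have eq: "integral {0..1} (\<lambda>r. integral {0..1} (\<lambda>t. 1 / (N t r + h)
        - (t + s) * ((t *\<^sub>R a + r *\<^sub>R b + e) \<bullet> a) / (N t r * (N t r + h)\<^sup>2)))
      = integral {0..1} (\<lambda>r. (1 + s) * (1 / (N 1 r + h)) - s * (1 / (N 0 r + h)))"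
    by (intro integral_cong) simp
  have "(\<lambda>r. 1 / (N t r + h)) integrable_on {0..1}" if t: "t \<in> {0..1}" for t
  proof (rule integrable_continuous_real)
    have "N t r + h \<noteq> 0" if "r \<in> {0..1}" for r
      using N[OF t that] h by simp
    then show "continuous_on {0..1} (\<lambda>r. 1 / (N t r + h))"
      unfolding N_def by (intro continuous_intros) blast
  qed
  then show ?thesis
    unfolding eq
    by (intro integral_unique has_integral_diff has_integral_mult_right integrable_integral) auto
qed

text \<open>Treats the sides \<open>c = 0\<close> and \<open>c = 1\<close> together. The factor
  \<open>c + s\<close> stays on both sides: when it vanishes, \<open>h1 = 0\<close>, and
  \<open>Ihat1\<close> may be unspecified if the height is 0 too. Otherwise \<open>nd\<close> keeps
  one of the two heights nonzero.\<close>

lemma boundary_term_eq_Ihat1: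
  fixes a b e :: "'a::euclidean_space"
  assumes b: "b \<noteq> 0" and nd: "height {a, b} e = 0 \<Longrightarrow> \<not> collinear {0, a, b}"
    and par: "par {a, b} e = s *\<^sub>R a + r *\<^sub>R b"
  shows "(c + s) * integral {0..1} (\<lambda>t. 1 / (norm (c *\<^sub>R a + t *\<^sub>R b + e) + height {a, b} e))
    = (c + s) * Ihat1 (height {a, b} e) b (par {a, b} e + c *\<^sub>R a)"
proof (cases "c + s = 0")
  case False
  let ?h = "height {a, b} e" and ?p = "par {a, b} e"
  have h: "0 \<le> ?h" by (simp add: height_def)
  have "?p + c *\<^sub>R a = (c + s) *\<^sub>R a + r *\<^sub>R b"
    by (simp add: par algebra_simps)
  then have "height {b} (?p + c *\<^sub>R a) \<noteq> 0 \<or> ?h \<noteq> 0"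
    using height_singleton_ne_0[OF nd False] by auto
  then have "Ihat1 ?h b (?p + c *\<^sub>R a)
      = integral {0..1} (\<lambda>t. 1 / (sqrt ((norm (t *\<^sub>R b + (?p + c *\<^sub>R a)))\<^sup>2 + ?h\<^sup>2) + ?h))"
    by (rule Ihat1_eq_integral[OF b h])
  moreover have "sqrt ((norm (t *\<^sub>R b + (?p + c *\<^sub>R a)))\<^sup>2 + ?h\<^sup>2) = norm (c *\<^sub>R a + t *\<^sub>R b + e)" for t
  proof -
    have "c *\<^sub>R a + t *\<^sub>R b \<in> span {a, b}"
      by (intro span_add span_scale span_base) auto
    from norm_add_height[OF this, of e] show ?thesis
      by (simp add: real_sqrt_unique algebra_simps)
  qed
  ultimately show ?thesis by simp
qed simp

text \<open>
  With \<open>u = (t + s1) a1 + (r + s2) a2\<close>, \<open>N\<^sup>2 = |u|\<^sup>2 + h\<^sup>2\<close> and \<open>F = 1 / (N + h)\<close> one has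
  \<open>1 / N = \<partial>\<^sub>t ((t + s1) F) + \<partial>\<^sub>r ((r + s2) F)\<close>, which reduces the double integral to the boundary
  of the unit square.
\<close>

lemma Qhat_eq_integral:
  fixes a1 a2 e :: "'a::euclidean_space"
  assumes a: "a1 \<noteq> 0" "a2 \<noteq> 0"
    and nd: "height {a1, a2} e = 0 \<Longrightarrow> \<not> collinear {0, a1, a2}"
    and ne: "\<And>t r. t \<in> {0..1} \<Longrightarrow> r \<in> {0..1} \<Longrightarrow> t *\<^sub>R a1 + r *\<^sub>R a2 + e \<noteq> 0"
    and par: "par {a1, a2} e = s1 *\<^sub>R a1 + s2 *\<^sub>R a2"
  shows "Qhat s1 s2 a1 a2 e
    = integral {0..1} (\<lambda>t. integral {0..1} (\<lambda>r. 1 / norm (t *\<^sub>R a1 + r *\<^sub>R a2 + e)))"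
proof -
  define h where "h = height {a1, a2} e"
  define v where "v t r = t *\<^sub>R a1 + r *\<^sub>R a2 + e" for t r
  define g1 where "g1 t r = 1 / (norm (v t r) + h)
    - (t + s1) * (v t r \<bullet> a1) / (norm (v t r) * (norm (v t r) + h)\<^sup>2)" for t r
  define g2 where "g2 t r = 1 / (norm (v t r) + h)
    - (r + s2) * (v t r \<bullet> a2) / (norm (v t r) * (norm (v t r) + h)\<^sup>2)" for t r
  have h: "0 \<le> h" by (simp add: h_def height_def)
  have v: "norm (v t r) > 0" if "t \<in> {0..1}" "r \<in> {0..1}" for t r
    using ne[OF that] by (simp add: v_def)
  have ne': "t *\<^sub>R a2 + r *\<^sub>R a1 + e \<noteq> 0" if "t \<in> {0..1}" "r \<in> {0..1}" for t r
    using ne[OF that(2,1)] by (simp add: add.commute[of "t *\<^sub>R a2"])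
  have comm: "{a2, a1} = {a1, a2}" by auto
  have sum: "1 / norm (v t r) = g1 t r + g2 t r" if tr: "t \<in> {0..1}" "r \<in> {0..1}" for t r
  proof -
    let ?N = "norm (v t r)"
    have N: "0 < ?N" "0 < ?N + h" using v[OF tr] h by (auto intro: add_pos_nonneg)
    \<comment> \<open>\<open>u\<close> is the projection of \<open>v t r\<close> onto the span. Any
      coefficients representing the projection of \<open>e\<close> give the same \<open>u\<close>,
      so parallel \<open>a1\<close> and \<open>a2\<close> are covered.\<close>
    define u where "u = (t + s1) *\<^sub>R a1 + (r + s2) *\<^sub>R a2"
    have w: "t *\<^sub>R a1 + r *\<^sub>R a2 \<in> span {a1, a2}"
      by (intro span_add span_scale span_base) auto
    have u: "u = t *\<^sub>R a1 + r *\<^sub>R a2 + par {a1, a2} e"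
      by (simp add: u_def par algebra_simps)
    have "u \<in> span {a1, a2}"
      unfolding u by (intro span_add w par_mem)
    then have "orthogonal (e - par {a1, a2} e) u"
      by (rule orthogonal_par)
    moreover have "v t r = u + (e - par {a1, a2} e)"
      by (simp add: v_def u)
    ultimately have "v t r \<bullet> u = u \<bullet> u"
      by (simp add: orthogonal_def inner_add_left)
    also have "u \<bullet> u = ?N\<^sup>2 - h\<^sup>2"
      using norm_add_height[OF w, of e] by (simp add: v_def u h_def power2_norm_eq_inner)
    finally have vu: "(t + s1) * (v t r \<bullet> a1) + (r + s2) * (v t r \<bullet> a2) = ?N\<^sup>2 - h\<^sup>2"
      by (simp add: u_def inner_add_right)
    \<comment> \<open>By \<open>vu\<close> the numerator is (N - h) (N + h), so the sum is 2 / (N +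
      h) - (N - h) / (N (N + h)) = 1 / N.\<close>
    have "g1 t r + g2 t r = 2 / (?N + h)
        - ((t + s1) * (v t r \<bullet> a1) + (r + s2) * (v t r \<bullet> a2)) / (?N * (?N + h)\<^sup>2)"
      by (simp add: g1_def g2_def add_divide_distrib)
    also have "\<dots> = 2 / (?N + h) - (?N - h) * (?N + h) / (?N * (?N + h)\<^sup>2)"
      unfolding vu by (simp add: power2_eq_square algebra_simps)
    also have "\<dots> = 1 / ?N"
      using N by (simp add: divide_simps power2_eq_square)
    finally show ?thesis by simp
  qed
  have cont: "continuous_on (cbox (0, 0) (1, 1)) (\<lambda>(t, r). g1 t r)"
    "continuous_on (cbox (0, 0) (1, 1)) (\<lambda>(t, r). g2 t r)"
  proof -
    have "norm (v (fst z) (snd z)) \<noteq> 0" "norm (v (fst z) (snd z)) + h \<noteq> 0"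
      if "z \<in> cbox (0, 0) (1, 1)" for z
      using v[of "fst z" "snd z"] h that by (auto simp: cbox_Pair_eq add_nonneg_eq_0_iff)
    then show "continuous_on (cbox (0, 0) (1, 1)) (\<lambda>(t, r). g1 t r)"
      "continuous_on (cbox (0, 0) (1, 1)) (\<lambda>(t, r). g2 t r)"
      unfolding g1_def g2_def case_prod_unfold v_def
      by (intro continuous_intros; simp)+
  qed
  have int: "(\<lambda>t. integral {0..1} (g t)) integrable_on {0..1}"
    "\<And>t. t \<in> {0..1} \<Longrightarrow> g t integrable_on {0..1}"
    if "continuous_on (cbox (0, 0) (1, 1)) (\<lambda>(t, r). g t r)" for g :: "real \<Rightarrow> real \<Rightarrow> real"
  proof -
    show "(\<lambda>t. integral {0..1} (g t)) integrable_on {0..1}"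
      using integral_integrable_2dim[OF that] by simp
    fix t :: real assume "t \<in> {0..1}"
    then show "g t integrable_on {0..1}"
      by (intro integrable_continuous_real)
        (use continuous_on_compose2[OF that, of "{0..1}" "\<lambda>r. (t, r)"] in
          \<open>auto simp: cbox_Pair_eq continuous_on_Pair image_subset_iff\<close>)
  qed
  have "integral {0..1} (\<lambda>t. integral {0..1} (\<lambda>r. 1 / norm (v t r)))
      = integral {0..1} (\<lambda>t. integral {0..1} (g1 t) + integral {0..1} (g2 t))"
  proof (rule integral_cong)
    fix t :: real assume t: "t \<in> {0..1}"
    have "integral {0..1} (\<lambda>r. 1 / norm (v t r)) = integral {0..1} (\<lambda>r. g1 t r + g2 t r)"
      by (rule integral_cong) (rule sum[OF t])
    also have "\<dots> = integral {0..1} (g1 t) + integral {0..1} (g2 t)"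
      by (intro Henstock_Kurzweil_Integration.integral_add int(2)[OF _ t] cont)
    finally show "integral {0..1} (\<lambda>r. 1 / norm (v t r)) = integral {0..1} (g1 t) + integral {0..1} (g2 t)" .
  qed
  also have "\<dots> = integral {0..1} (\<lambda>t. integral {0..1} (g1 t)) + integral {0..1} (\<lambda>t. integral {0..1} (g2 t))"
    by (intro Henstock_Kurzweil_Integration.integral_add int(1) cont)
  \<comment> \<open>\<open>g1\<close> is a derivative in \<open>t\<close>, so \<open>t\<close> must
    become the inner variable; \<open>g2\<close> already has \<open>r\<close> inside.\<close>
  also have "integral {0..1} (\<lambda>t. integral {0..1} (g1 t)) = integral {0..1} (\<lambda>r. integral {0..1} (\<lambda>t. g1 t r))"
    using integral_swap_continuous[OF cont(1)] by simp
  also have "\<dots> = (1 + s1) * integral {0..1} (\<lambda>r. 1 / (norm (1 *\<^sub>R a1 + r *\<^sub>R a2 + e) + h))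
      - s1 * integral {0..1} (\<lambda>r. 1 / (norm (0 *\<^sub>R a1 + r *\<^sub>R a2 + e) + h))"
    unfolding g1_def v_def by (rule integral_partial_term[OF ne h])
  also have "integral {0..1} (\<lambda>t. integral {0..1} (g2 t))
      = (1 + s2) * integral {0..1} (\<lambda>t. 1 / (norm (1 *\<^sub>R a2 + t *\<^sub>R a1 + e) + h))
      - s2 * integral {0..1} (\<lambda>t. 1 / (norm (0 *\<^sub>R a2 + t *\<^sub>R a1 + e) + h))"
    unfolding g2_def v_def add.commute[of "_ *\<^sub>R a1" "_ *\<^sub>R a2"]
    by (rule integral_partial_term[OF ne' h])
  also have "(1 + s1) * integral {0..1} (\<lambda>r. 1 / (norm (1 *\<^sub>R a1 + r *\<^sub>R a2 + e) + h))
      = (1 + s1) * Ihat1 h a2 (par {a1, a2} e + 1 *\<^sub>R a1)"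
    unfolding h_def by (rule boundary_term_eq_Ihat1[OF a(2) nd par])
  also have "s1 * integral {0..1} (\<lambda>r. 1 / (norm (0 *\<^sub>R a1 + r *\<^sub>R a2 + e) + h))
      = s1 * Ihat1 h a2 (par {a1, a2} e)"
    using boundary_term_eq_Ihat1[OF a(2) nd par, of 0] by (simp add: h_def)
  \<comment> \<open>On the sides with \<open>r\<close> fixed, \<open>a1\<close> and
    \<open>a2\<close> exchange roles; height and projection depend only on the set of the two
    vectors.\<close>
  also have "(1 + s2) * integral {0..1} (\<lambda>t. 1 / (norm (1 *\<^sub>R a2 + t *\<^sub>R a1 + e) + h))
      = (1 + s2) * Ihat1 h a1 (par {a1, a2} e + 1 *\<^sub>R a2)"
    using boundary_term_eq_Ihat1[of a1 a2 e s2 s1 1] a(1) nd par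
    by (simp add: h_def comm insert_commute[of 0] add.commute)
  also have "s2 * integral {0..1} (\<lambda>t. 1 / (norm (0 *\<^sub>R a2 + t *\<^sub>R a1 + e) + h))
      = s2 * Ihat1 h a1 (par {a1, a2} e)"
    using boundary_term_eq_Ihat1[of a1 a2 e s2 s1 0] a(1) nd par
    by (simp add: h_def comm insert_commute[of 0] add.commute)
  finally show ?thesis
    by (simp add: Qhat_def Let_def h_def v_def)
qed

lemma edge_integral_eq_Qhat:
  fixes x y :: "nat \<Rightarrow> real^3"
  assumes colx: "\<not> collinear {x 1, x 2, x 3}" and coly: "\<not> collinear {y 1, y 2, y 3}"
    and disj: "flat_triangle x \<inter> flat_triangle y = {}"
    and ij: "i \<in> {1..3}" "j \<in> {1..3}"
    and nc: "\<not> collinear {0, edge x i, edge y j, x i - y j}"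
    and par: "par {edge x i, - edge y j} (x i - y j) = s1 *\<^sub>R edge x i + s2 *\<^sub>R (- edge y j)"
  shows "edge_integral x y i j
    = norm (edge x i) * norm (edge y j) * Qhat s1 s2 (edge x i) (- edge y j) (x i - y j)"
proof -
  let ?a = "edge x i" and ?b = "edge y j" and ?e = "x i - y j"
  have a: "?a \<noteq> 0" and b: "- ?b \<noteq> 0"
    using edge_nonzero[OF colx ij(1)] edge_nonzero[OF coly ij(2)] by simp_all
  \<comment> \<open>If the height is 0 and the edges are parallel, \<open>?e\<close> lies on their
    common line as well, against \<open>nc\<close>. This is how the hypothesis rules out
    \<open>h1 = h2 = 0\<close>.\<close>
  have nd: "\<not> collinear {0, ?a, - ?b}" if "height {?a, - ?b} ?e = 0"
  proof
    assume "collinear {0, ?a, - ?b}"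
    then obtain c where c: "- ?b = c *\<^sub>R ?a"
      using a b by (auto simp: collinear_lemma)
    have "?e = s1 *\<^sub>R ?a + s2 *\<^sub>R (- ?b)"
      using that par by (simp add: height_def)
    then have e: "?e = (s1 + s2 * c) *\<^sub>R ?a"
      unfolding c by (simp add: scaleR_add_left)
    have "?b = (- c) *\<^sub>R ?a"
      using c by (metis minus_minus scaleR_minus_left)
    then have "\<exists>k. w = k *\<^sub>R ?a" if "w \<in> {0, ?a, ?b, ?e}" for w
      using that e by (metis emptyE insertE scaleR_one scaleR_zero_left)
    then have "collinear {0, ?a, ?b, ?e}"
      unfolding collinear_def by (metis scaleR_left_diff_distrib)
    with nc show False by contradiction
  qed
  have eq: "t *\<^sub>R ?a + r *\<^sub>R (- ?b) + ?e = t *\<^sub>R ?a - r *\<^sub>R ?b + x i - y j" for t r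
    by simp
  have ne: "t *\<^sub>R ?a + r *\<^sub>R (- ?b) + ?e \<noteq> 0" if "t \<in> {0..1}" "r \<in> {0..1}" for t r
    using edge_points_distinct[OF ij disj that] by (simp add: algebra_simps)
  have "Qhat s1 s2 ?a (- ?b) ?e
    = integral {0..1} (\<lambda>t. integral {0..1} (\<lambda>r. 1 / norm (t *\<^sub>R ?a + r *\<^sub>R (- ?b) + ?e)))"
    by (rule Qhat_eq_integral[OF a b nd ne par])
  then show ?thesis
    by (simp only: edge_integral_def eq)
qed

theorem mainTheorem4:
  fixes x y :: "nat \<Rightarrow> real^3"
  assumes "\<not> collinear {x 1, x 2, x 3}"
    and "\<not> collinear {y 1, y 2, y 3}"
    and "flat_triangle x \<inter> flat_triangle y = {}"
  shows "triangle_integral y (\<lambda>q. normal y \<bullet>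
            grad (\<lambda>q'. triangle_integral x (\<lambda>p. normal x \<bullet> grad (\<lambda>p'. newton_kernel p' q') p)) q)
         = - (\<Sum>i=1..3. \<Sum>j=1..3.
               (edge x i \<bullet> edge y j) / (norm (edge x i) * norm (edge y j)) * edge_integral x y i j)
       \<and> (\<forall>i\<in>{1..3}. \<forall>j\<in>{1..3}.
            \<not> collinear {0, edge x i, edge y j, x i - y j} \<longrightarrow>
            (\<forall>s1 s2. par {edge x i, - edge y j} (x i - y j)
                      = s1 *\<^sub>R edge x i + s2 *\<^sub>R (- edge y j) \<longrightarrow>
               edge_integral x y i j
               = norm (edge x i) * norm (edge y j)
                 * Qhat s1 s2 (edge x i) (- edge y j) (x i - y j)))"
  using double_layer_flux[OF assms] edge_integral_eq_Qhat[OF assms] by blast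

end
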